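(* Let $\mathcal{M}=\{M(\theta)=(G(q,\theta),R(q,\theta),H(q,\theta),\Lambda(\theta)),\ \theta\in\Theta\}$ be a network model set, with $L$ nodes, $K$ external excitation signals and noise rank $p\le L$, that satisfies at least one of the conditions (C1), (C2), (C3) listed in the context. Let $U(q,\theta):=\begin{bmatrix}R(q,\theta)&H(q,\theta)\end{bmatrix}$ and $T(q,\theta):=(I-G(q,\theta))^{-1}U(q,\theta)$. Suppose additionally that: (a) every parametrized entry in the model $\{M(z,\theta),\theta\in\Theta\}$ covers the set of all proper rational transfer functions; (b) all parametrized transfer functions in the model $M(z,\theta)$ are parametrized independently (i.e. there are no common parameters); where (a) and (b) are understood within the constraints imposed on the model set, as made precise in the context. Then: 1. For $\theta_0\in\Theta$, $\mathcal{M}$ is globally network identifiable at $M(\theta_0)$ if and only if - each row $i$ of the transfer function matrix $\begin{bmatrix}G(\theta)&U(\theta)\end{bmatrix}$ has at most $K+p$ parametrized entries, and - for each $i=1,\dots,L$, the matrix $\check T_i(\theta_0)$ (the submatrix of $T(q,\theta_0)$ defined in the context) has full row rank. 2. $\mathcal{M}$ is globally network identifiable if and only if - each row $i$ of the transfer function matrix $\begin{bmatrix}G(\theta)&U(\theta)\end{bmatrix}$ has at most $K+p$ parametrized entries, and - for each $i=1,\dots,L$, $\check T_i(\theta)$ has full row rank for all $\theta\in\Theta$.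
   Context: Notation. $\mathbb{R}^{m\times n}(z)$ is the set of $m\times n$ matrices of real rational functions in $z$ (rank over the field of rational functions); $q$ is the forward shift operator, so $A(q)$ and $A(z)$ denote the same rational transfer matrix. $A^\infty:=\lim_{z\to\infty}A(z)$; $A_{i\star}$ is the $i$-th row of $A$. "Stable" means all poles in the open unit disc (and proper); a square matrix $A$ is monic if $A^\infty=I$. $(\cdot)^*$ is complex conjugate transpose (on the unit circle $z=e^{i\omega}$). Network model. The network is $w=Gw+Rr+He$ with $w$ the $L$ node signals, $r$ the $K$ measured external excitation signals, $e$ an unmeasured $p$-dimensional white noise with covariance $\Lambda$, $p\le L$. A network model is a quadruple $M=(G,R,H,\Lambda)$ with: $G\in\mathbb{R}^{L\times L}(z)$ having zero diagonal and all entries ("modules") proper and stable; $R\in\mathbb{R}^{L\times K}(z)$ proper; $H\in\mathbb{R}^{L\times p}(z)$ stable, of the form $H=\begin{bmatrix}H_a\\H_b\end{bmatrix}$ with $H_a$ a $p\times p$ monic matrix, and having a stable left inverse $H^\dagger$, $H^\dagger H=I_p$ (for $p=L$: $H$ square, monic, stable, minimum-phase); $\Lambda\in\mathbb{R}^{p\times p}$, $\Lambda>0$; the network is well-posed (all principal minors of $(I-G^\infty)^{-1}$ are nonzero), with $(I-G)^{-1}$ proper and stable. Network model set. A set $\mathcal{M}=\{M(\theta)=(G(q,\theta),R(q,\theta),H(q,\theta),\Lambda(\theta)):\theta\in\Theta\}$ of network models with common $L,K,p$. All models share the same $p$, and the nodes are ordered so that for all models the first $p$ components of $v=He$ form a full-rank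 process. Each entry of a parametrized matrix is either parametrized (depends on $\theta$) or fixed (a known value, the same for all $\theta\in\Theta$); in particular the diagonal of $G$ is fixed to $0$. Derived objects. $T_{wr}(q,\theta)=(I-G(q,\theta))^{-1}R(q,\theta)$, $T_{we}(q,\theta)=(I-G(q,\theta))^{-1}H(q,\theta)$, so $T=\begin{bmatrix}T_{wr}&T_{we}\end{bmatrix}$; and $\Phi_{\bar v}(\omega,\theta)=T_{we}(e^{i\omega},\theta)\Lambda(\theta)T_{we}(e^{i\omega},\theta)^*$. Global network identifiability. $\mathcal{M}$ is globally network identifiable at $M(\theta_0)$ if for all $\theta_1\in\Theta$: $T_{wr}(q,\theta_1)=T_{wr}(q,\theta_0)$ and $\Phi_{\bar v}(\omega,\theta_1)=\Phi_{\bar v}(\omega,\theta_0)$ together imply $M(\theta_1)=M(\theta_0)$ (equality of quadruples). $\mathcal{M}$ is globally network identifiable if this holds for all $\theta_0\in\Theta$. Conditions. (C1) $G^\infty(\theta)=0$ for all $\theta\in\Theta$. (C2) There is a permutation matrix $\Pi$ such that $\Pi^TG^\infty(\theta)\Pi$ is upper triangular for all $\theta\in\Theta$ (no algebraic loops), and $H^\infty(\theta)\Lambda(\theta)H^\infty(\theta)^T$ is diagonal for all $\theta\in\Theta$. (C3) For all $\theta\in\Theta$: each row of $\begin{bmatrix}G^\infty(\theta)&R^\infty(\theta)\end{bmatrix}$ has at most $K$ parametrized elements, and for each $i=1,\dots,L$ the matrix $\check T_i^\infty(\theta)$ has full row rank. Here, with $a_i,b_i$ the numbers of parametrized elements in row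 $i$ of $I-G^\infty(\theta)$ and $R^\infty(\theta)$, $\check T_i^\infty(\theta)$ is the $a_i\times(K-b_i)$ submatrix of $T_{wr}^\infty(\theta)$ with rows indexed by the columns where $G^\infty(\theta)_{i\star}$ is parametrized and columns indexed by the columns where $R^\infty(\theta)_{i\star}$ is not parametrized. The matrices $\check T_i$. Let row $i$ of $G(\theta)$ have $\alpha_i$ parametrized entries and row $i$ of $U(\theta)$ have $\beta_i$ parametrized entries. Let $P_i$ ($L\times L$) and $Q_i$ ($(K+p)\times(K+p)$) be permutation matrices such that in $(I-G(\theta))_{i\star}P_i$ the parametrized entries are the first $\alpha_i$ ones, and in $U(\theta)_{i\star}Q_i$ the parametrized entries are the last $\beta_i$ ones. Then $$\check T_i(q,\theta):=\begin{bmatrix}I_{\alpha_i}&0\end{bmatrix}P_i^{-1}T(q,\theta)Q_i\begin{bmatrix}I_{K+p-\beta_i}\\0\end{bmatrix},$$ i.e. the $\alpha_i\times(K+p-\beta_i)$ submatrix of $T$ with rows indexed by the columns where $G(\theta)_{i\star}$ is parametrized and columns indexed by the columns where $U(\theta)_{i\star}$ is not parametrized. Meaning of (a) and (b). The parametrized entries of $G,R,H$ vary freely and independently of each other and of $\Lambda$ over all proper rational transfer functions, subject only to the constraints on the model set: if $\theta\in\Theta$ and $M'=(G',R',H',\Lambda(\theta))$ is a network model that has the same fixed entries of $G,R,H$ as the model set and that satisfies the requirements which the assumed condition imposes on each model (under (C1): $G'^\infty=0$; under (C2): $\Pi^TG'^\infty\Pi$ upper triangular and $H'^\infty\Lambda(\theta)H'^{\infty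 T}$ diagonal; under (C3): $G'^\infty,R'^\infty$ have the same fixed entries as $G^\infty(\cdot),R^\infty(\cdot)$, and the corresponding matrices $\check T_i^\infty$ have full row rank), then $M'\in\mathcal{M}$. *)

theory Defs
  imports
    "HOL-Computational_Algebra.Field_as_Ring"
    "HOL-Computational_Algebra.Polynomial_Factorial"
    "HOL-Computational_Algebra.Normalized_Fraction"
    "HOL-Combinatorics.Permutations"
    "Jordan_Normal_Form.DL_Rank"
    "Jordan_Normal_Form.DL_Submatrix"
    "Jordan_Normal_Form.Gauss_Jordan_Elimination"
    "Jordan_Normal_Form.Schur_Decomposition"
begin

section \<open>Rational transfer functions\<close>

type_synonym ratfun = "real poly fract"

text \<open>
  \<^const>\<open>quot_of_fract\<close> yields numerator and denominator in lowest terms, so the complex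
  roots of the denominator are exactly the finite poles.
\<close>

definition rf_num :: "ratfun \<Rightarrow> real poly" where
  "rf_num f = fst (quot_of_fract f)"

definition rf_den :: "ratfun \<Rightarrow> real poly" where
  "rf_den f = snd (quot_of_fract f)"

definition rf_eval :: "ratfun \<Rightarrow> complex \<Rightarrow> complex" where
  "rf_eval f z = poly (map_poly of_real (rf_num f)) z / poly (map_poly of_real (rf_den f)) z"

definition rf_poles :: "ratfun \<Rightarrow> complex set" where
  "rf_poles f = {z. poly (map_poly of_real (rf_den f)) z = 0}"

definition rf_proper :: "ratfun \<Rightarrow> bool" where
  "rf_proper f \<longleftrightarrow> degree (rf_num f) \<le> degree (rf_den f)"

definition rf_stable :: "ratfun \<Rightarrow> bool" where
  "rf_stable f \<longleftrightarrow> rf_proper f \<and> (\<forall>z \<in> rf_poles f. cmod z < 1)"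

text \<open>
  The limit for \<open>z \<rightarrow> \<infinity>\<close>; for proper functions it exists and is real because the coefficients
  are. It is only used for proper functions.
\<close>

definition rf_inf :: "ratfun \<Rightarrow> real" where
  "rf_inf f = Re (Lim at_infinity (rf_eval f))"

definition proper_mat :: "ratfun mat \<Rightarrow> bool" where
  "proper_mat A \<longleftrightarrow> (\<forall>i < dim_row A. \<forall>j < dim_col A. rf_proper (A $$ (i, j)))"

definition stable_mat :: "ratfun mat \<Rightarrow> bool" where
  "stable_mat A \<longleftrightarrow> (\<forall>i < dim_row A. \<forall>j < dim_col A. rf_stable (A $$ (i, j)))"

abbreviation mat_inf :: "ratfun mat \<Rightarrow> real mat" where
  "mat_inf A \<equiv> map_mat rf_inf A"


section \<open>Matrices\<close>

text \<open>Only used for invertible matrices.\<close>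

definition minv :: "'a::field mat \<Rightarrow> 'a mat" where
  "minv A = the (mat_inverse A)"

definition append_cols :: "'a::zero mat \<Rightarrow> 'a mat \<Rightarrow> 'a mat" where
  "append_cols A B = four_block_mat A B (0\<^sub>m 0 (dim_col A)) (0\<^sub>m 0 (dim_col B))"

definition full_row_rank :: "'a::field mat \<Rightarrow> bool" where
  "full_row_rank A \<longleftrightarrow> vec_space.rank (dim_row A) A = dim_row A"

definition permutation_matrix :: "nat \<Rightarrow> real mat \<Rightarrow> bool" where
  "permutation_matrix n P \<longleftrightarrow>
     (\<exists>\<sigma>. \<sigma> permutes {..<n} \<and> P = mat n n (\<lambda>(i, j). if i = \<sigma> j then 1 else 0))"

definition pos_def_mat :: "nat \<Rightarrow> real mat \<Rightarrow> bool" where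
  "pos_def_mat n A \<longleftrightarrow> A \<in> carrier_mat n n \<and> transpose_mat A = A \<and>
     (\<forall>x \<in> carrier_vec n. x \<noteq> 0\<^sub>v n \<longrightarrow> x \<bullet> (A *\<^sub>v x) > 0)"


section \<open>Network models\<close>

record net_model =
  netG :: "ratfun mat"
  netR :: "ratfun mat"
  netH :: "ratfun mat"
  netLambda :: "real mat"

definition netU :: "net_model \<Rightarrow> ratfun mat" where
  "netU m = append_cols (netR m) (netH m)"

definition netGU :: "net_model \<Rightarrow> ratfun mat" where
  "netGU m = append_cols (netG m) (netU m)"

definition I_minus_G_inv :: "net_model \<Rightarrow> ratfun mat" where
  "I_minus_G_inv m = minv (1\<^sub>m (dim_row (netG m)) - netG m)"

definition net_Twr :: "net_model \<Rightarrow> ratfun mat" where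
  "net_Twr m = I_minus_G_inv m * netR m"

definition net_Twe :: "net_model \<Rightarrow> ratfun mat" where
  "net_Twe m = I_minus_G_inv m * netH m"

definition net_T :: "net_model \<Rightarrow> ratfun mat" where
  "net_T m = I_minus_G_inv m * netU m"

definition net_Phi :: "net_model \<Rightarrow> real \<Rightarrow> complex mat" where
  "net_Phi m \<omega> =
     (let T\<omega> = map_mat (\<lambda>f. rf_eval f (cis \<omega>)) (net_Twe m)
      in T\<omega> * map_mat complex_of_real (netLambda m) * mat_adjoint T\<omega>)"

definition well_posed :: "nat \<Rightarrow> ratfun mat \<Rightarrow> bool" where
  "well_posed L G \<longleftrightarrow> invertible_mat (1\<^sub>m L - mat_inf G) \<and>
     (\<forall>I \<subseteq> {..<L}. det (submatrix (minv (1\<^sub>m L - mat_inf G)) I I) \<noteq> 0)"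

text \<open>
  \<open>submatrix (netH m) {..<p} UNIV\<close> is the upper block \<open>H\<^sub>a\<close>. Since it is monic, its determinant
  is a nonzero rational function, so that the first \<open>p\<close> components of \<open>v = H e\<close> automatically
  form a full-rank process.
\<close>

definition network_model :: "nat \<Rightarrow> nat \<Rightarrow> nat \<Rightarrow> net_model \<Rightarrow> bool" where
  "network_model L K p m \<longleftrightarrow>
     p \<le> L \<and>
     netG m \<in> carrier_mat L L \<and> stable_mat (netG m) \<and> (\<forall>i < L. netG m $$ (i, i) = 0) \<and>
     netR m \<in> carrier_mat L K \<and> proper_mat (netR m) \<and>
     netH m \<in> carrier_mat L p \<and> stable_mat (netH m) \<and>
     mat_inf (submatrix (netH m) {..<p} UNIV) = 1\<^sub>m p \<and>
     (\<exists>Hd \<in> carrier_mat p L. stable_mat Hd \<and> Hd * netH m = 1\<^sub>m p) \<and>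
     pos_def_mat p (netLambda m) \<and>
     well_posed L (netG m) \<and>
     invertible_mat (1\<^sub>m L - netG m) \<and> stable_mat (I_minus_G_inv m)"


section \<open>Network model sets\<close>

text \<open>
  A model set is a family \<open>M\<close> of models over a parameter set \<open>\<Theta>\<close>. An entry of a parametrized
  matrix \<open>A\<close> is parametrized if it depends on \<open>\<theta> \<in> \<Theta>\<close> and fixed otherwise; rows and columns
  are numbered from 0.
\<close>

definition network_model_set ::
  "nat \<Rightarrow> nat \<Rightarrow> nat \<Rightarrow> 'a set \<Rightarrow> ('a \<Rightarrow> net_model) \<Rightarrow> bool" where
  "network_model_set L K p \<Theta> M \<longleftrightarrow> p \<le> L \<and> (\<forall>\<theta> \<in> \<Theta>. network_model L K p (M \<theta>))"

definition param_cols :: "'a set \<Rightarrow> ('a \<Rightarrow> 'b mat) \<Rightarrow> nat \<Rightarrow> nat set" where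
  "param_cols \<Theta> A i =
     {j. \<exists>\<theta> \<in> \<Theta>. \<exists>\<theta>' \<in> \<Theta>. j < dim_col (A \<theta>) \<and> A \<theta> $$ (i, j) \<noteq> A \<theta>' $$ (i, j)}"

definition same_fixed_entries :: "'a set \<Rightarrow> ('a \<Rightarrow> 'b mat) \<Rightarrow> 'b mat \<Rightarrow> bool" where
  "same_fixed_entries \<Theta> A B \<longleftrightarrow>
     (\<forall>\<theta> \<in> \<Theta>. \<forall>i < dim_row (A \<theta>). \<forall>j < dim_col (A \<theta>).
        j \<notin> param_cols \<Theta> A i \<longrightarrow> B $$ (i, j) = A \<theta> $$ (i, j))"

definition globally_identifiable_at :: "'a set \<Rightarrow> ('a \<Rightarrow> net_model) \<Rightarrow> 'a \<Rightarrow> bool" where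
  "globally_identifiable_at \<Theta> M \<theta>0 \<longleftrightarrow>
     (\<forall>\<theta>1 \<in> \<Theta>. net_Twr (M \<theta>1) = net_Twr (M \<theta>0) \<and> net_Phi (M \<theta>1) = net_Phi (M \<theta>0)
        \<longrightarrow> M \<theta>1 = M \<theta>0)"

definition globally_identifiable :: "'a set \<Rightarrow> ('a \<Rightarrow> net_model) \<Rightarrow> bool" where
  "globally_identifiable \<Theta> M \<longleftrightarrow> (\<forall>\<theta>0 \<in> \<Theta>. globally_identifiable_at \<Theta> M \<theta>0)"


subsection \<open>Conditions on the feedthrough terms\<close>

text \<open>
  Each condition is split into the requirement \<open>req_C\<dots>\<close> it imposes on a single model and the
  condition \<open>cond_C\<dots>\<close> on the family: strictly proper modules (C1); no algebraic loops and
  diagonal noise feedthrough (C2); sufficiently rich external excitation (C3).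
\<close>

definition req_C1 :: "nat \<Rightarrow> net_model \<Rightarrow> bool" where
  "req_C1 L m \<longleftrightarrow> mat_inf (netG m) = 0\<^sub>m L L"

definition cond_C1 :: "nat \<Rightarrow> 'a set \<Rightarrow> ('a \<Rightarrow> net_model) \<Rightarrow> bool" where
  "cond_C1 L \<Theta> M \<longleftrightarrow> (\<forall>\<theta> \<in> \<Theta>. req_C1 L (M \<theta>))"

definition req_C2 :: "real mat \<Rightarrow> net_model \<Rightarrow> bool" where
  "req_C2 P m \<longleftrightarrow>
     upper_triangular (transpose_mat P * mat_inf (netG m) * P) \<and>
     diagonal_mat (mat_inf (netH m) * netLambda m * transpose_mat (mat_inf (netH m)))"

definition cond_C2 :: "nat \<Rightarrow> 'a set \<Rightarrow> ('a \<Rightarrow> net_model) \<Rightarrow> real mat \<Rightarrow> bool" where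
  "cond_C2 L \<Theta> M P \<longleftrightarrow> permutation_matrix L P \<and> (\<forall>\<theta> \<in> \<Theta>. req_C2 P (M \<theta>))"

definition G_inf :: "('a \<Rightarrow> net_model) \<Rightarrow> 'a \<Rightarrow> real mat" where
  "G_inf M \<theta> = mat_inf (netG (M \<theta>))"

definition R_inf :: "('a \<Rightarrow> net_model) \<Rightarrow> 'a \<Rightarrow> real mat" where
  "R_inf M \<theta> = mat_inf (netR (M \<theta>))"

text \<open>
  \<open>T_check_inf K \<Theta> M m i\<close> takes its row and column index sets from the family \<open>M\<close> and its
  entries from the model \<open>m\<close>, which need not belong to the family.
\<close>

definition T_check_inf ::
  "nat \<Rightarrow> 'a set \<Rightarrow> ('a \<Rightarrow> net_model) \<Rightarrow> net_model \<Rightarrow> nat \<Rightarrow> real mat" where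
  "T_check_inf K \<Theta> M m i =
     submatrix (mat_inf (net_Twr m)) (param_cols \<Theta> (G_inf M) i) ({..<K} - param_cols \<Theta> (R_inf M) i)"

definition req_C3 :: "nat \<Rightarrow> nat \<Rightarrow> 'a set \<Rightarrow> ('a \<Rightarrow> net_model) \<Rightarrow> net_model \<Rightarrow> bool" where
  "req_C3 L K \<Theta> M m \<longleftrightarrow>
     same_fixed_entries \<Theta> (G_inf M) (mat_inf (netG m)) \<and>
     same_fixed_entries \<Theta> (R_inf M) (mat_inf (netR m)) \<and>
     (\<forall>i < L. full_row_rank (T_check_inf K \<Theta> M m i))"

definition cond_C3 :: "nat \<Rightarrow> nat \<Rightarrow> 'a set \<Rightarrow> ('a \<Rightarrow> net_model) \<Rightarrow> bool" where
  "cond_C3 L K \<Theta> M \<longleftrightarrow>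
     (\<forall>i < L. card (param_cols \<Theta> (\<lambda>\<theta>. append_cols (G_inf M \<theta>) (R_inf M \<theta>)) i) \<le> K) \<and>
     (\<forall>\<theta> \<in> \<Theta>. \<forall>i < L. full_row_rank (T_check_inf K \<Theta> M (M \<theta>) i))"


subsection \<open>Free and independent parametrization\<close>

text \<open>
  The parametrized entries of \<open>G\<close>, \<open>R\<close>, \<open>H\<close> range freely and independently over all proper rational
  functions, within the class of network models that satisfy the requirement \<open>req\<close>.
\<close>

definition freely_parametrized ::
  "nat \<Rightarrow> nat \<Rightarrow> nat \<Rightarrow> 'a set \<Rightarrow> ('a \<Rightarrow> net_model) \<Rightarrow> (net_model \<Rightarrow> bool) \<Rightarrow> bool" where
  "freely_parametrized L K p \<Theta> M req \<longleftrightarrow>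
     (\<forall>\<theta> \<in> \<Theta>. \<forall>m'.
        network_model L K p m' \<and> netLambda m' = netLambda (M \<theta>) \<and>
        same_fixed_entries \<Theta> (\<lambda>\<theta>. netG (M \<theta>)) (netG m') \<and>
        same_fixed_entries \<Theta> (\<lambda>\<theta>. netR (M \<theta>)) (netR m') \<and>
        same_fixed_entries \<Theta> (\<lambda>\<theta>. netH (M \<theta>)) (netH m') \<and>
        req m' \<longrightarrow> m' \<in> M ` \<Theta>)"


subsection \<open>The matrices \<open>\<check>T\<^sub>i\<close>\<close>

definition T_check ::
  "nat \<Rightarrow> nat \<Rightarrow> 'a set \<Rightarrow> ('a \<Rightarrow> net_model) \<Rightarrow> 'a \<Rightarrow> nat \<Rightarrow> ratfun mat" where
  "T_check K p \<Theta> M \<theta> i =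
     submatrix (net_T (M \<theta>))
       (param_cols \<Theta> (\<lambda>\<theta>. netG (M \<theta>)) i)
       ({..<K + p} - param_cols \<Theta> (\<lambda>\<theta>. netU (M \<theta>)) i)"

end

theory Submission
  imports Defs
begin

text \<open>
  The data are \<open>T\<^sub>w\<^sub>r\<close> and the noise spectrum. Two stable left-invertible factors of a spectrum agree up to a constant matrix (reflection in the unit circle and
  Liouville), and each of the conditions on the feedthrough forces this constant to be trivial, so
  equal data mean equal \<open>T\<close> and \<open>\<Lambda>\<close>. Given \<open>T\<close>, models correspond to solutions of
  \<open>(I - G) T = U\<close>, which is solved row by row: two solutions differ in row \<open>i\<close> by a left null vector
  of \<open>\<check>T\<^sub>i\<close>. Conversely, a left null vector, multiplied by a small stable strictly proper
  function, can be added to row \<open>i\<close> of \<open>G\<close> without losing stability or changing any feedthrough,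
  which yields a second model in the set with the same data.
\<close>

section \<open>Rational functions as quotients of polynomials\<close>

text \<open>Three obstacles shape the proof. The noise may be rank deficient (p < L); then T_we is
  not square, so two spectral factors are compared through stable left inverses. Under (C2) the
  feedthrough of G may differ between the two models; the constant is then a triangular matrix with
  the diagonal of \<Lambda>, and uniqueness of the LDL factorisation removes its off-diagonal part.
  Under (C1) and (C3) both models have the same feedthrough of G, and the monic block of H settles
  the constant. Finally, a left null vector of \<open>T_check\<close> may be improper and have poles
  anywhere, while the perturbed model must lie in the set again. The multiplier therefore clears the
  denominators, supplies a high power of 1/z and carries a small constant, so that the rank-one
  update of (I - G)^-1 stays stable by an estimate in the style of Rouche. The bound K + p on the
  parametrized entries comes out of full row rank, which forces at least as many columns as
  rows.\<close>

abbreviation cpoly :: "real poly \<Rightarrow> complex poly" where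
  "cpoly \<equiv> map_poly complex_of_real"

lemma cpoly_mult: "cpoly (a * b) = cpoly a * cpoly b"
  by (simp add: poly_eq_iff coeff_map_poly coeff_mult)

lemma cpoly_eq_0_iff: "cpoly a = 0 \<longleftrightarrow> a = 0"
  by (auto simp: poly_eq_iff coeff_map_poly)

lemma degree_cpoly: "degree (cpoly a) = degree a"
  by (simp add: degree_map_poly)

lemma Fract_rf_num_den: "Fract (rf_num f) (rf_den f) = f"
  by (simp add: rf_num_def rf_den_def)

lemma rf_den_neq_0: "rf_den f \<noteq> 0"
  by (simp add: rf_den_def)

lemma rf_num_den_cross:
  assumes "b \<noteq> 0"
  shows "a * rf_den (Fract a b) = rf_num (Fract a b) * b"
  using Fract_rf_num_den[of "Fract a b"] rf_den_neq_0[of "Fract a b"] assms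
  by (simp add: eq_fract)

lemma rf_den_dvd:
  assumes "b \<noteq> 0"
  shows "rf_den (Fract a b) dvd b"
proof -
  have "rf_den (Fract a b) dvd rf_num (Fract a b) * b"
    by (metis rf_num_den_cross[OF assms] dvd_triv_right)
  moreover have "coprime (rf_den (Fract a b)) (rf_num (Fract a b))"
    using coprime_quot_of_fract[of "Fract a b"] by (simp add: rf_num_def rf_den_def coprime_commute)
  ultimately show ?thesis
    by (simp add: coprime_dvd_mult_right_iff)
qed

text \<open>Cancelling a common factor lowers both degrees by the same amount, so properness can be
  read off any representation.\<close>

lemma rf_proper_Fract_iff:
  assumes "b \<noteq> 0"
  shows "rf_proper (Fract a b) \<longleftrightarrow> degree a \<le> degree b"
proof (cases "a = 0")
  case True
  then show ?thesis using rf_num_den_cross[OF assms, of a] assms by (auto simp: rf_proper_def)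
next
  case False
  let ?n = "rf_num (Fract a b)" and ?d = "rf_den (Fract a b)"
  have "?n \<noteq> 0" using rf_num_den_cross[OF assms, of a] rf_den_neq_0 False by auto
  moreover have "degree (a * ?d) = degree (?n * b)" using rf_num_den_cross[OF assms] by simp
  ultimately have "degree a + degree ?d = degree ?n + degree b"
    using False assms rf_den_neq_0 by (simp add: degree_mult_eq)
  then show ?thesis by (auto simp: rf_proper_def)
qed

text \<open>The reduced denominator divides \<open>b\<close>, hence is nonzero wherever
  \<open>b\<close> is.\<close>

lemma rf_eval_Fract:
  assumes "poly (cpoly b) z \<noteq> 0"
  shows "rf_eval (Fract a b) z = poly (cpoly a) z / poly (cpoly b) z"
    and "z \<notin> rf_poles (Fract a b)"
proof -
  let ?n = "rf_num (Fract a b)" and ?d = "rf_den (Fract a b)"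
  have b: "b \<noteq> 0" using assms by auto
  obtain e where "b = ?d * e" using rf_den_dvd[OF b, of a] by (auto simp: dvd_def)
  then have "poly (cpoly b) z = poly (cpoly ?d) z * poly (cpoly e) z"
    by (metis cpoly_mult poly_mult)
  then have d: "poly (cpoly ?d) z \<noteq> 0" using assms by auto
  have "poly (cpoly a) z * poly (cpoly ?d) z = poly (cpoly ?n) z * poly (cpoly b) z"
    using rf_num_den_cross[OF b, of a] by (metis cpoly_mult poly_mult)
  then show "rf_eval (Fract a b) z = poly (cpoly a) z / poly (cpoly b) z"
    using d assms by (simp add: rf_eval_def frac_eq_eq)
  show "z \<notin> rf_poles (Fract a b)" using d by (simp add: rf_poles_def)
qed

section \<open>Schur polynomials as denominators of stable functions\<close>

definition schur_poly :: "real poly \<Rightarrow> bool" where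
  "schur_poly b \<longleftrightarrow> b \<noteq> 0 \<and> (\<forall>z. poly (cpoly b) z = 0 \<longrightarrow> cmod z < 1)"

lemma schur_poly_mult: "schur_poly a \<Longrightarrow> schur_poly b \<Longrightarrow> schur_poly (a * b)"
  by (auto simp: schur_poly_def cpoly_mult)

lemma schur_poly_1: "schur_poly 1"
  by (simp add: schur_poly_def)

lemma schur_poly_monom: "schur_poly (monom 1 m)"
  by (auto simp: schur_poly_def of_real_hom.map_poly_hom_monom poly_monom)

lemma schur_poly_nonzero: "schur_poly b \<Longrightarrow> cmod z \<ge> 1 \<Longrightarrow> poly (cpoly b) z \<noteq> 0"
  by (force simp: schur_poly_def)

text \<open>Together with \<open>rf_stableE\<close> this lets later arguments use any fraction with
  a Schur denominator, in lowest terms or not.\<close>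

lemma rf_stableI:
  assumes "schur_poly b" "degree a \<le> degree b"
  shows "rf_stable (Fract a b)"
  using assms rf_eval_Fract(2)[of b _ a]
  by (force simp: rf_stable_def rf_proper_Fract_iff schur_poly_def)

lemma rf_stableE:
  assumes "rf_stable f"
  obtains a b where "f = Fract a b" "schur_poly b" "degree a \<le> degree b"
  using assms Fract_rf_num_den[of f, symmetric] rf_den_neq_0[of f]
  by (auto simp: rf_stable_def rf_proper_def rf_poles_def schur_poly_def)

lemma rf_properE:
  assumes "rf_proper f"
  obtains a b where "f = Fract a b" "b \<noteq> 0" "degree a \<le> degree b"
  using assms Fract_rf_num_den[of f, symmetric] rf_den_neq_0[of f]
  by (auto simp: rf_proper_def)

lemma rf_stable_proper: "rf_stable f \<Longrightarrow> rf_proper f"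
  by (simp add: rf_stable_def)

text \<open>\<open>rev_poly n a\<close> is \<open>x\<^sup>n a(1/x)\<close>.\<close>

definition rev_poly :: "nat \<Rightarrow> 'a::field poly \<Rightarrow> 'a poly" where
  "rev_poly n a = monom 1 (n - degree a) * reflect_poly a"

lemma poly_rev_poly:
  fixes z :: "'a::field"
  assumes "degree a \<le> n" "z \<noteq> 0"
  shows "poly a z = z ^ n * poly (rev_poly n a) (inverse z)"
proof -
  have "z ^ n = z ^ degree a * z ^ (n - degree a)" using assms by (simp flip: power_add)
  then show ?thesis
    using assms poly_reflect_poly_nz[of "inverse z" a]
    by (simp add: rev_poly_def poly_monom field_simps)
qed

lemma poly_rev_poly_0:
  assumes "degree a \<le> n"
  shows "poly (rev_poly n a) 0 = coeff a n"
proof (cases "degree a = n")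
  case True
  then show ?thesis by (auto simp: rev_poly_def)
next
  case False
  then have "degree a < n" using assms by simp
  then show ?thesis by (simp add: rev_poly_def poly_monom coeff_eq_0)
qed

text \<open>The substitution of 1/z for z turns the limit into continuity of the reversed polynomial
  at 0.\<close>

lemma poly_over_power_at_infinity:
  fixes a :: "complex poly"
  assumes "degree a \<le> n"
  shows "((\<lambda>z. poly a z / z ^ n) \<longlongrightarrow> coeff a n) at_infinity"
proof -
  have "((\<lambda>z. poly (rev_poly n a) (inverse z)) \<longlongrightarrow> poly (rev_poly n a) 0) at_infinity"
    by (intro tendsto_intros tendsto_inverse_0)
  moreover have "eventually (\<lambda>z::complex. z \<noteq> 0) at_infinity"
    by (auto simp: eventually_at_infinity intro!: exI[of _ 1])
  then have "eventually (\<lambda>z. poly (rev_poly n a) (inverse z) = poly a z / z ^ n) at_infinity"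
    by eventually_elim (use poly_rev_poly[OF assms] in auto)
  ultimately show ?thesis
    using poly_rev_poly_0[OF assms] by (auto elim: Lim_transform_eventually)
qed

lemma at_infinity_complex_neq_bot: "(at_infinity :: complex filter) \<noteq> bot"
proof
  assume "(at_infinity :: complex filter) = bot"
  then have "eventually (\<lambda>z::complex. False) at_infinity" by simp
  then obtain B where "\<And>z::complex. B \<le> norm z \<Longrightarrow> False" by (auto simp: eventually_at_infinity)
  from this[of "of_real B"] show False by (simp add: abs_ge_self)
qed

text \<open>Numerator and denominator are both divided by z^n, with n the degree of
  \<open>b\<close>. If \<open>a\<close> has smaller degree, \<open>coeff a (degree b)\<close> is 0,
  as it should be for a strictly proper function.\<close>

lemma rf_inf_Fract:
  assumes "b \<noteq> 0" "degree a \<le> degree b"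
  shows "rf_inf (Fract a b) = coeff a (degree b) / lead_coeff b"
proof -
  let ?n = "degree b"
  have "((\<lambda>z. poly (cpoly b) z / z ^ ?n) \<longlongrightarrow> coeff (cpoly b) ?n) at_infinity"
    by (intro poly_over_power_at_infinity) (simp add: degree_cpoly)
  moreover have "coeff (cpoly b) ?n \<noteq> 0" using assms by (simp add: coeff_map_poly)
  ultimately have "eventually (\<lambda>z. poly (cpoly b) z / z ^ ?n \<noteq> 0) at_infinity"
    by (rule tendsto_imp_eventually_ne)
  then have "eventually (\<lambda>z. poly (cpoly b) z \<noteq> 0) at_infinity"
    by eventually_elim auto
  moreover have "eventually (\<lambda>z::complex. z \<noteq> 0) at_infinity"
    by (auto simp: eventually_at_infinity intro!: exI[of _ 1])
  ultimately have ev: "eventually (\<lambda>z. (poly (cpoly a) z / z ^ ?n) / (poly (cpoly b) z / z ^ ?n)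
      = rf_eval (Fract a b) z) at_infinity"
    by eventually_elim (simp add: rf_eval_Fract)
  have "((\<lambda>z. (poly (cpoly a) z / z ^ ?n) / (poly (cpoly b) z / z ^ ?n))
      \<longlongrightarrow> coeff (cpoly a) ?n / coeff (cpoly b) ?n) at_infinity"
    using assms by (intro tendsto_divide poly_over_power_at_infinity)
       (auto simp: degree_cpoly coeff_map_poly)
  from Lim_transform_eventually[OF this ev]
  have "Lim at_infinity (rf_eval (Fract a b)) = coeff (cpoly a) ?n / coeff (cpoly b) ?n"
    using at_infinity_complex_neq_bot by (intro tendsto_Lim)
  then show ?thesis by (simp add: rf_inf_def coeff_map_poly flip: of_real_divide)
qed


subsection \<open>Ring homomorphisms defined on subrings\<close>

text \<open>Evaluation respects sums and products only away from poles: at infinity on the proper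
  functions, at a point of modulus at least 1 on the stable ones. The locale covers both, and with
  \<open>S = UNIV\<close> also the embedding of the constants.\<close>

locale partial_ring_hom =
  fixes S :: "'a::comm_ring_1 set" and h :: "'a \<Rightarrow> 'b::comm_ring_1"
  assumes zero_closed: "0 \<in> S" and one_closed: "1 \<in> S"
    and add_closed: "x \<in> S \<Longrightarrow> y \<in> S \<Longrightarrow> x + y \<in> S"
    and mult_closed: "x \<in> S \<Longrightarrow> y \<in> S \<Longrightarrow> x * y \<in> S"
    and uminus_closed: "x \<in> S \<Longrightarrow> - x \<in> S"
    and hom_zero: "h 0 = 0" and hom_one: "h 1 = 1"
    and hom_add: "x \<in> S \<Longrightarrow> y \<in> S \<Longrightarrow> h (x + y) = h x + h y"
    and hom_mult: "x \<in> S \<Longrightarrow> y \<in> S \<Longrightarrow> h (x * y) = h x * h y"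
    and hom_uminus: "x \<in> S \<Longrightarrow> h (- x) = - h x"
begin

lemma sum_closed: "(\<And>i. i \<in> A \<Longrightarrow> f i \<in> S) \<Longrightarrow> sum f A \<in> S"
  by (induction A rule: infinite_finite_induct) (auto simp: zero_closed add_closed)

lemma hom_sum: "(\<And>i. i \<in> A \<Longrightarrow> f i \<in> S) \<Longrightarrow> h (sum f A) = (\<Sum>i\<in>A. h (f i))"
proof (induction A rule: infinite_finite_induct)
  case (insert x F)
  then show ?case by (auto simp: hom_add sum_closed)
qed (auto simp: hom_zero)

lemma minus_closed: "x \<in> S \<Longrightarrow> y \<in> S \<Longrightarrow> x - y \<in> S"
  using add_closed[of x "- y"] uminus_closed[of y] by simp

lemma hom_minus: "x \<in> S \<Longrightarrow> y \<in> S \<Longrightarrow> h (x - y) = h x - h y"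
  using hom_add[of x "- y"] uminus_closed[of y] hom_uminus[of y] by simp

definition mat_over :: "'a mat \<Rightarrow> bool" where
  "mat_over A \<longleftrightarrow> (\<forall>i < dim_row A. \<forall>j < dim_col A. A $$ (i, j) \<in> S)"

lemma mat_over_one: "mat_over (1\<^sub>m n)"
  by (auto simp: mat_over_def zero_closed one_closed)

lemma mat_over_mult:
  assumes "mat_over A" "mat_over B" "dim_col A = dim_row B"
  shows "mat_over (A * B)"
  using assms by (auto simp: mat_over_def scalar_prod_def intro!: sum_closed mult_closed)

lemma mat_over_minus:
  assumes "mat_over A" "mat_over B" "dim_row A = dim_row B" "dim_col A = dim_col B"
  shows "mat_over (A - B)"
  using assms by (auto simp: mat_over_def intro!: minus_closed)

lemma hom_mat_one: "map_mat h (1\<^sub>m n) = 1\<^sub>m n"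
  by (auto simp: hom_zero hom_one)

lemma hom_mat_mult:
  assumes "mat_over A" "mat_over B" "dim_col A = dim_row B"
  shows "map_mat h (A * B) = map_mat h A * map_mat h B"
  using assms
  by (intro eq_matI)
     (auto simp: mat_over_def scalar_prod_def hom_mult mult_closed intro!: trans[OF hom_sum] sum.cong)

lemma mat_over_add:
  assumes "mat_over A" "mat_over B" "dim_row A = dim_row B" "dim_col A = dim_col B"
  shows "mat_over (A + B)"
  using assms by (auto simp: mat_over_def intro!: add_closed)

lemma mat_over_smult: "c \<in> S \<Longrightarrow> mat_over A \<Longrightarrow> mat_over (c \<cdot>\<^sub>m A)"
  by (auto simp: mat_over_def intro!: mult_closed)

lemma hom_mat_add:
  assumes "mat_over A" "mat_over B" "dim_row A = dim_row B" "dim_col A = dim_col B"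
  shows "map_mat h (A + B) = map_mat h A + map_mat h B"
  using assms by (intro eq_matI) (auto simp: mat_over_def hom_add)

lemma hom_mat_minus:
  assumes "mat_over A" "mat_over B" "dim_row A = dim_row B" "dim_col A = dim_col B"
  shows "map_mat h (A - B) = map_mat h A - map_mat h B"
  using assms by (intro eq_matI) (auto simp: mat_over_def hom_minus)

end

section \<open>Evaluation at infinity and outside the open unit disc\<close>

lemma rf_properI: "b \<noteq> 0 \<Longrightarrow> degree a \<le> degree b \<Longrightarrow> rf_proper (Fract a b)"
  by (simp add: rf_proper_Fract_iff)

lemma degree_cross_add_le:
  fixes a b c d :: "'a::idom poly"
  assumes "b \<noteq> 0" "d \<noteq> 0" "degree a \<le> degree b" "degree c \<le> degree d"
  shows "degree (a * d + c * b) \<le> degree (b * d)"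
proof -
  have "degree (a * d) \<le> degree b + degree d" "degree (c * b) \<le> degree b + degree d"
    using assms degree_mult_le[of a d] degree_mult_le[of c b] by auto
  then show ?thesis using assms by (simp add: degree_mult_eq degree_add_le)
qed

lemma degree_mult_le_mult:
  fixes a b c d :: "'a::idom poly"
  assumes "b \<noteq> 0" "d \<noteq> 0" "degree a \<le> degree b" "degree c \<le> degree d"
  shows "degree (a * c) \<le> degree (b * d)"
  using assms degree_mult_le[of a c] by (simp add: degree_mult_eq)

text \<open>Degree bounds in place of exact degrees include strictly proper factors in the proof
  that the value at infinity is multiplicative.\<close>

lemma coeff_mult_top:
  fixes a c :: "'a::comm_semiring_0 poly"
  assumes "degree a \<le> m" "degree c \<le> n"
  shows "coeff (a * c) (m + n) = coeff a m * coeff c n"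
proof (cases "degree a = m \<and> degree c = n")
  case True
  then show ?thesis using coeff_mult_degree_sum[of a c] by auto
next
  case False
  then have "degree a < m \<or> degree c < n" using assms by auto
  moreover from this have "degree (a * c) < m + n"
    using assms degree_mult_le[of a c] by linarith
  ultimately show ?thesis by (auto simp: coeff_eq_0)
qed

interpretation rf_inf: partial_ring_hom "Collect rf_proper" rf_inf
proof unfold_locales
  fix x y :: ratfun
  assume "x \<in> Collect rf_proper" "y \<in> Collect rf_proper"
  then obtain a b c d where x: "x = Fract a b" "b \<noteq> 0" "degree a \<le> degree b"
    and y: "y = Fract c d" "d \<noteq> 0" "degree c \<le> degree d"
    by (auto elim!: rf_properE)
  have le: "degree (a * d + c * b) \<le> degree (b * d)" "degree (a * c) \<le> degree (b * d)"
    using x y by (intro degree_cross_add_le degree_mult_le_mult; simp)+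
  show "x + y \<in> Collect rf_proper" "x * y \<in> Collect rf_proper"
    using x y le by (auto intro!: rf_properI)
  have dm: "degree (b * d) = degree b + degree d"
    using x y by (simp add: degree_mult_eq)
  have co: "coeff (a * d) (degree (b * d)) = coeff a (degree b) * lead_coeff d"
    "coeff (c * b) (degree (b * d)) = coeff c (degree d) * lead_coeff b"
    "coeff (a * c) (degree (b * d)) = coeff a (degree b) * coeff c (degree d)"
    using x y coeff_mult_top[of a "degree b" d "degree d"] coeff_mult_top[of c "degree d" b "degree b"]
      coeff_mult_top[of a "degree b" c "degree d"]
    by (simp_all only: dm order_refl add.commute[of "degree d" "degree b"])
  show "rf_inf (x + y) = rf_inf x + rf_inf y" "rf_inf (x * y) = rf_inf x * rf_inf y"
    using x y le co by (simp_all add: rf_inf_Fract lead_coeff_mult add_frac_eq)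
  show "- x \<in> Collect rf_proper" "rf_inf (- x) = - rf_inf x"
    using x by (auto intro!: rf_properI simp: rf_inf_Fract)
qed (auto simp: rf_inf_Fract Zero_fract_def One_fract_def intro!: rf_properI)

lemma rf_eval_hom:
  assumes "cmod z \<ge> 1"
  shows "partial_ring_hom (Collect rf_stable) (\<lambda>f. rf_eval f z)"
proof unfold_locales
  fix x y :: ratfun
  assume "x \<in> Collect rf_stable" "y \<in> Collect rf_stable"
  then obtain a b c d where x: "x = Fract a b" "schur_poly b" "degree a \<le> degree b"
    and y: "y = Fract c d" "schur_poly d" "degree c \<le> degree d"
    by (auto elim!: rf_stableE)
  have nz: "b \<noteq> 0" "d \<noteq> 0" using x y by (auto simp: schur_poly_def)
  have bd: "schur_poly (b * d)" using x y by (simp add: schur_poly_mult)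
  have le: "degree (a * d + c * b) \<le> degree (b * d)" "degree (a * c) \<le> degree (b * d)"
    using x y nz by (intro degree_cross_add_le degree_mult_le_mult; simp)+
  show "x + y \<in> Collect rf_stable" "x * y \<in> Collect rf_stable"
    using x y le nz bd by (auto intro!: rf_stableI)
  have ev: "poly (cpoly b) z \<noteq> 0" "poly (cpoly d) z \<noteq> 0"
    using x y assms by (simp_all add: schur_poly_nonzero)
  show "rf_eval (x + y) z = rf_eval x z + rf_eval y z" "rf_eval (x * y) z = rf_eval x z * rf_eval y z"
    using x y nz ev
    by (simp_all add: rf_eval_Fract cpoly_mult of_real_hom.map_poly_hom_add add_frac_eq)
  have "cpoly (- a) = - cpoly a" by (simp add: poly_eq_iff coeff_map_poly)
  then show "- x \<in> Collect rf_stable" "rf_eval (- x) z = - rf_eval x z"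
    using x ev by (auto intro!: rf_stableI simp: rf_eval_Fract)
qed (auto simp: rf_eval_Fract Zero_fract_def One_fract_def schur_poly_1 intro!: rf_stableI)

definition rf_const :: "real \<Rightarrow> ratfun" where
  "rf_const c = Fract [:c:] 1"

lemma rf_stable_const: "rf_stable (rf_const c)"
  by (auto simp: rf_const_def schur_poly_1 intro!: rf_stableI)

lemma rf_inf_const: "rf_inf (rf_const c) = c"
  by (simp add: rf_const_def rf_inf_Fract)

lemma rf_eval_const: "rf_eval (rf_const c) z = of_real c"
  by (simp add: rf_const_def rf_eval_Fract of_real_hom.map_poly_pCons_hom)

text \<open>Liouville: \<open>f\<close> extends to the unit disc by reflecting \<open>g\<close> in the circle. In terms of
  polynomials: with \<open>f = a/b\<close> and \<open>g = c/d\<close>, the relation on the circle reads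
  \<open>a * rev d = rev c * b\<close>, and the roots of \<open>b\<close> and \<open>rev d\<close> are separated by the circle.\<close>

lemma stable_reflection_const:
  assumes "rf_stable f" "rf_stable g"
    and refl: "\<And>\<omega>. rf_eval f (cis \<omega>) = cnj (rf_eval g (cis \<omega>))"
  obtains k where "f = rf_const k"
proof -
  obtain a b where f: "f = Fract a b" "schur_poly b" "degree a \<le> degree b"
    using assms(1) by (elim rf_stableE)
  obtain c d where g: "g = Fract c d" "schur_poly d" "degree c \<le> degree d"
    using assms(2) by (elim rf_stableE)
  let ?n = "degree d"
  let ?C = "rev_poly ?n (cpoly c)" and ?D = "rev_poly ?n (cpoly d)"
  have b0: "b \<noteq> 0" and d0: "d \<noteq> 0" using f g by (auto simp: schur_poly_def)
  \<comment> \<open>On the circle the conjugate of z is 1/z, so the conjugate of g(z) is g(1/z), a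
    quotient of reversed polynomials.\<close>
  have eq: "poly (cpoly a * ?D) (cis \<omega>) = poly (?C * cpoly b) (cis \<omega>)" for \<omega>
  proof -
    let ?z = "cis \<omega>"
    have z: "cmod ?z = 1" "?z \<noteq> 0" by simp_all
    have bz: "poly (cpoly b) ?z \<noteq> 0" and dz: "poly (cpoly d) (cnj ?z) \<noteq> 0" "poly (cpoly d) ?z \<noteq> 0"
      using f g z by (simp_all add: schur_poly_nonzero)
    have cn: "cnj (poly (cpoly q) ?z) = poly (cpoly q) (cnj ?z)" for q
      by (simp add: poly_altdef degree_cpoly coeff_map_poly)
    have inv: "inverse (cnj ?z) = ?z" by (simp add: cis_cnj)
    have rev: "poly (cpoly q) (cnj ?z) = cnj ?z ^ ?n * poly (rev_poly ?n (cpoly q)) ?z"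
      if "degree q \<le> ?n" for q
      using poly_rev_poly[of "cpoly q" ?n "cnj ?z"] that z inv by (simp add: degree_cpoly)
    have "poly (cpoly a) ?z / poly (cpoly b) ?z = poly (cpoly c) (cnj ?z) / poly (cpoly d) (cnj ?z)"
      using refl[of \<omega>] f g bz dz by (simp add: rf_eval_Fract cn)
    also have "\<dots> = poly ?C ?z / poly ?D ?z"
      using rev[of c] rev[of d] g z by simp
    finally show ?thesis using bz dz rev[of d] by (auto simp: field_simps)
  qed
  \<comment> \<open>The circle is infinite because \<open>cos\<close> is injective on
    \<open>{0..pi}\<close>; a polynomial identity on it therefore holds identically.\<close>
  have inf: "infinite (range cis)"
  proof
    assume "finite (range cis)"
    then have "finite (Re ` cis ` {0..pi})" by (meson finite_imageI finite_subset image_mono subset_UNIV)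
    moreover have "Re ` cis ` {0..pi} = cos ` {0..pi}" by (simp add: image_image)
    moreover have "inj_on cos {0..pi}" by (auto simp: inj_on_def intro: cos_inj_pi)
    ultimately have "finite {0..pi}" by (metis finite_imageD)
    then show False using pi_gt_zero by (simp add: infinite_Icc)
  qed
  have "cpoly a * ?D = ?C * cpoly b"
  proof (rule ccontr)
    assume "\<not> ?thesis"
    then have "finite {z. poly (cpoly a * ?D - ?C * cpoly b) z = 0}" by (intro poly_roots_finite) simp
    moreover have "range cis \<subseteq> {z. poly (cpoly a * ?D - ?C * cpoly b) z = 0}" using eq by auto
    ultimately show False using inf finite_subset by blast
  qed
  then have dvd: "cpoly b dvd cpoly a * ?D" by simp
  \<comment> \<open>Roots of \<open>cpoly b\<close> lie in the open disc; nonzero roots of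
    \<open>?D\<close> are inverses of roots of \<open>d\<close> and lie outside the closed disc. At
    0 the value of \<open>?D\<close> is the leading coefficient of \<open>d\<close>.\<close>
  have "coprime (cpoly b) ?D"
  proof (rule coprimeI)
    fix q assume q: "q dvd cpoly b" "q dvd ?D"
    show "is_unit q"
    proof (rule ccontr)
      assume "\<not> is_unit q"
      moreover have "q \<noteq> 0" using q(1) b0 by (auto simp: cpoly_eq_0_iff)
      ultimately have "degree q > 0" by (simp add: is_unit_iff_degree)
      then obtain w where w: "poly q w = 0" by (metis alg_closed_imp_poly_has_root)
      then have b: "poly (cpoly b) w = 0" and D: "poly ?D w = 0" using q by (auto simp: dvd_def)
      show False
      proof (cases "w = 0")
        case True
        then show False using D d0 by (simp add: poly_rev_poly_0 degree_cpoly coeff_map_poly)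
      next
        case False
        then have "poly (cpoly d) (inverse w) = 0"
          using poly_rev_poly[of "cpoly d" ?n "inverse w"] D by (simp add: degree_cpoly)
        then have "cmod (inverse w) < 1" using g(2) by (simp add: schur_poly_def)
        moreover have "cmod w < 1" using b f(2) by (simp add: schur_poly_def)
        ultimately show False using False by (simp add: norm_divide field_simps)
      qed
    qed
  qed
  then have "cpoly b dvd cpoly a" using dvd by (simp add: coprime_dvd_mult_left_iff)
  then have "b dvd a" by (rule of_real_hom.dvd_map_poly_hom_imp_dvd)
  then obtain e where e: "a = b * e" by (auto simp: dvd_def)
  \<comment> \<open>\<open>f\<close> is proper, so \<open>a = b * e\<close> has degree at most that
    of \<open>b\<close>.\<close>
  have "degree e = 0"
    using f b0 e by (cases "e = 0") (auto simp: degree_mult_eq)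
  then obtain k where "e = [:k:]" by (metis degree_eq_zeroE)
  then have "f = rf_const k" using f e b0 by (simp add: rf_const_def eq_fract)
  then show thesis by (rule that)
qed

section \<open>Full row rank and inverses\<close>

lemma zero_scalar_prod_lincomb:
  fixes x :: "'a::field vec"
  assumes "finite U" "U \<subseteq> carrier_vec n" "x \<in> carrier_vec n" "\<And>u. u \<in> U \<Longrightarrow> x \<bullet> u = 0"
  shows "x \<bullet> module.lincomb (module_vec TYPE('a) n) a U = 0"
proof -
  interpret vec_space "TYPE('a)" n .
  have d: "dim_vec (lincomb a U) = n" using lincomb_dim[OF assms(1,2)] .
  have "x \<bullet> lincomb a U = (\<Sum>i<n. x $ i * (\<Sum>u\<in>U. a u * u $ i))"
    unfolding scalar_prod_def d atLeast0LessThan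
    by (intro sum.cong) (use assms(2) in \<open>auto simp: lincomb_index\<close>)
  also have "\<dots> = (\<Sum>u\<in>U. a u * (\<Sum>i<n. x $ i * u $ i))"
    unfolding sum_distrib_left by (subst sum.swap) (simp add: mult_ac)
  also have "\<dots> = (\<Sum>u\<in>U. a u * (x \<bullet> u))"
    using assms(2) by (intro sum.cong) (auto simp: scalar_prod_def atLeast0LessThan)
  finally show ?thesis using assms by simp
qed

text \<open>Maximality puts every column into the span of \<open>us\<close>, so a vector orthogonal
  to \<open>us\<close> is orthogonal to all columns of \<open>A\<close>. The list form serves to
  build a square matrix from them.\<close>

lemma maximal_independent_cols:
  fixes A :: "'a::field mat"
  assumes "A \<in> carrier_mat n nc"
  obtains us where "set us \<subseteq> set (cols A)" "distinct us" "length us = vec_space.rank n A"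
    "\<not> module.lin_dep class_ring (module_vec TYPE('a) n) (set us)"
    "set (cols A) \<subseteq> LinearCombinations.module.span class_ring (module_vec TYPE('a) n) (set us)"
proof -
  interpret vec_space "TYPE('a)" n .
  have "\<exists>U. finite U \<and> maximal U (\<lambda>T. T \<subseteq> set (cols A) \<and> lin_indpt T) \<and> {} \<subseteq> U"
    by (rule maximal_exists_superset[of "set (cols A)"]) (auto simp: lin_dep_def)
  then obtain U where U: "finite U" "maximal U (\<lambda>T. T \<subseteq> set (cols A) \<and> lin_indpt T)" by blast
  have card: "card U = rank A" using rank_card_indpt[OF assms U(2)] by simp
  have sub: "U \<subseteq> set (cols A)" "lin_indpt U" using U(2) by (auto simp: maximal_def)
  have carr: "set (cols A) \<subseteq> carrier_vec n" using assms cols_dim by blast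
  have "c \<in> span U" if c: "c \<in> set (cols A)" for c
  proof (rule ccontr)
    assume nc: "c \<notin> span U"
    have "c \<notin> U" using nc in_own_span sub(1) carr by auto
    moreover have "lin_indpt (insert c U)"
      using nc sub carr c lin_dep_iff_in_span[of U c] \<open>c \<notin> U\<close> by auto
    ultimately show False using U(2) c sub(1) unfolding maximal_def by blast
  qed
  moreover obtain us where "set us = U" "distinct us" using finite_distinct_list[OF U(1)] by blast
  ultimately show thesis
    using card sub by (intro that[of us]) (auto simp: distinct_card subset_iff)
qed

text \<open>A maximal independent set of columns, padded with zero columns, is a singular square
  matrix unless \<open>A\<close> has full row rank.\<close>

lemma full_row_rank_iff_left_kernel:
  fixes A :: "'a::field mat"
  assumes A: "A \<in> carrier_mat n nc"
  shows "full_row_rank A \<longleftrightarrow>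
    (\<forall>x \<in> carrier_vec n. (\<forall>j < nc. x \<bullet> col A j = 0) \<longrightarrow> x = 0\<^sub>v n)"
proof -
  interpret vec_space "TYPE('a)" n .
  obtain us where us: "set us \<subseteq> set (cols A)" "distinct us" "length us = rank A"
    "lin_indpt (set us)" "set (cols A) \<subseteq> span (set us)"
    using maximal_independent_cols[OF A] by blast
  have carr: "set (cols A) \<subseteq> carrier_vec n" using A cols_dim by blast
  have us_carr: "set us \<subseteq> carrier_vec n" using us carr by blast
  have cols_iff: "(\<forall>j < nc. x \<bullet> col A j = 0) \<longleftrightarrow> (\<forall>c \<in> set (cols A). x \<bullet> c = 0)" for x
    using A by (auto simp: cols_def)
  have le: "rank A \<le> n"
    using us(4) us_carr by (metis us(2,3) distinct_card li_le_dim(2) fin_dim dim_is_n)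
  show ?thesis
  proof
    assume "full_row_rank A"
    then have r: "rank A = n" using A by (simp add: full_row_rank_def)
    \<comment> \<open>At full rank the chosen columns form an invertible square matrix, and its
      transpose annihilates every \<open>x\<close> orthogonal to the columns of
      \<open>A\<close>.\<close>
    define B where "B = mat_of_cols n us"
    have B: "B \<in> carrier_mat n n" using us r by (simp add: B_def carrier_matI)
    have "cols B = us" using us_carr by (simp add: B_def)
    then have "rank B = n" using lin_indpt_full_rank[OF B] us by simp
    then have det: "det B \<noteq> 0" using det_rank_iff[OF B] by simp
    show "\<forall>x \<in> carrier_vec n. (\<forall>j < nc. x \<bullet> col A j = 0) \<longrightarrow> x = 0\<^sub>v n"
    proof (intro ballI impI)
      fix x :: "'a vec" assume x: "x \<in> carrier_vec n" and "\<forall>j < nc. x \<bullet> col A j = 0"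
      then have z: "\<forall>u \<in> set us. x \<bullet> u = 0" using us(1) cols_iff by blast
      have "transpose_mat B *\<^sub>v x = 0\<^sub>v n"
      proof (rule eq_vecI)
        fix i assume "i < dim_vec (0\<^sub>v n :: 'a vec)"
        then have i: "i < n" by simp
        then have "col B i = us ! i" using us r \<open>cols B = us\<close> B by (metis cols_nth carrier_matD(2))
        moreover have "us ! i \<in> set us" using i us r by simp
        ultimately show "(transpose_mat B *\<^sub>v x) $ i = 0\<^sub>v n $ i"
          using i B x z us_carr by (auto simp: comm_scalar_prod[of _ n x])
      qed (use B in simp)
      moreover have "det (transpose_mat B) \<noteq> 0" using det det_transpose[OF B] by simp
      ultimately show "x = 0\<^sub>v n"
        using det_0_iff_vec_prod_zero_field[of "transpose_mat B" n] B x by auto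
    qed
  next
    assume ker: "\<forall>x \<in> carrier_vec n. (\<forall>j < nc. x \<bullet> col A j = 0) \<longrightarrow> x = 0\<^sub>v n"
    show "full_row_rank A"
    proof (rule ccontr)
      assume "\<not> full_row_rank A"
      then have r: "rank A < n" using A le by (simp add: full_row_rank_def)
      define B where "B = mat n n (\<lambda>(i, j). if j < length us then us ! j $ i else 0)"
      have B: "B \<in> carrier_mat n n" by (simp add: B_def)
      have colB: "col B j = us ! j" if "j < length us" for j
      proof -
        have "us ! j \<in> carrier_vec n" using that us_carr nth_mem by blast
        then show ?thesis using that r us by (intro eq_vecI) (auto simp: B_def)
      qed
      \<comment> \<open>Column number \<open>rank A\<close> is the first padding column:
        \<open>us\<close> occupies the columns before it.\<close>
      have "B *\<^sub>v unit_vec n (rank A) = 0\<^sub>v n"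
        using r us by (intro eq_vecI) (auto simp: B_def)
      moreover have "unit_vec n (rank A) \<noteq> (0\<^sub>v n :: 'a vec)"
        using r by (metis index_unit_vec(1) index_zero_vec(1) zero_neq_one)
      ultimately have "det B = 0"
        using det_0_iff_vec_prod_zero_field[OF B] by (metis unit_vec_carrier)
      then have "det (transpose_mat B) = 0" using det_transpose[OF B] by simp
      then obtain x where x: "x \<in> carrier_vec n" "x \<noteq> 0\<^sub>v n" "transpose_mat B *\<^sub>v x = 0\<^sub>v n"
        using det_0_iff_vec_prod_zero_field[of "transpose_mat B" n] B by auto
      have "x \<bullet> u = 0" if u: "u \<in> set us" for u
      proof -
        obtain j where j: "j < length us" "u = us ! j" using u by (metis in_set_conv_nth)
        then have "(transpose_mat B *\<^sub>v x) $ j = u \<bullet> x" using B r us colB[OF j(1)] by simp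
        then show ?thesis using x j r us u us_carr by (simp add: comm_scalar_prod[of x n] subset_iff)
      qed
      then have "x \<bullet> c = 0" if "c \<in> set (cols A)" for c
        using that us(5) us_carr x(1) finite_in_span[of "set us" c]
          zero_scalar_prod_lincomb[of "set us" n x]
        by (metis List.finite_set subsetD)
      then show False using ker x cols_iff by blast
    qed
  qed
qed

lemma full_row_rank_dim_le: "full_row_rank A \<Longrightarrow> dim_row A \<le> dim_col A"
  using vec_space.rank_le_nc[of A "dim_row A" "dim_col A"] by (auto simp: full_row_rank_def)

lemma minv:
  fixes A :: "'a::field mat"
  assumes "A \<in> carrier_mat n n" "invertible_mat A"
  shows "minv A \<in> carrier_mat n n" "A * minv A = 1\<^sub>m n" "minv A * A = 1\<^sub>m n"
proof -
  obtain B where B: "A * B = 1\<^sub>m n" "B * A = 1\<^sub>m (dim_row B)"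
    using assms by (auto simp: invertible_mat_def inverts_mat_def)
  have "dim_col (A * B) = n" "dim_col (B * A) = dim_row B" using B by simp_all
  then have "B \<in> carrier_mat n n" using assms(1) by auto
  then have "A \<in> Units (ring_mat TYPE('a) n ())"
    using B assms(1) unfolding Units_def by (auto simp: ring_mat_simps)
  then have "mat_inverse A \<noteq> None" using mat_inverse(1)[OF assms(1), of "()"] by auto
  then show "minv A \<in> carrier_mat n n" "A * minv A = 1\<^sub>m n" "minv A * A = 1\<^sub>m n"
    using mat_inverse(2)[OF assms(1)] by (auto simp: minv_def)
qed

section \<open>Stable rational matrices on the unit circle\<close>

text \<open>The point 1 is an arbitrary choice on the circle; what is taken from this interpretation
  is the closure of the stable functions under the ring operations.\<close>

interpretation rf_stable: partial_ring_hom "Collect rf_stable" "\<lambda>f. rf_eval f 1"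
  by (rule rf_eval_hom) simp

interpretation rf_const: partial_ring_hom UNIV rf_const
  by unfold_locales (auto simp: rf_const_def Zero_fract_def One_fract_def mult.commute pCons_one)

lemma stable_mat_iff: "stable_mat A \<longleftrightarrow> rf_stable.mat_over A"
  by (simp add: stable_mat_def rf_stable.mat_over_def)

lemma proper_mat_iff: "proper_mat A \<longleftrightarrow> rf_inf.mat_over A"
  by (simp add: proper_mat_def rf_inf.mat_over_def)

lemma stable_mat_proper: "stable_mat A \<Longrightarrow> proper_mat A"
  by (simp add: stable_mat_def proper_mat_def rf_stable_proper)

lemma stable_mat_mult: "stable_mat A \<Longrightarrow> stable_mat B \<Longrightarrow> dim_col A = dim_row B \<Longrightarrow> stable_mat (A * B)"
  unfolding stable_mat_iff by (rule rf_stable.mat_over_mult)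

lemma proper_mat_mult: "proper_mat A \<Longrightarrow> proper_mat B \<Longrightarrow> dim_col A = dim_row B \<Longrightarrow> proper_mat (A * B)"
  unfolding proper_mat_iff by (rule rf_inf.mat_over_mult)

lemma mat_inf_mult: "proper_mat A \<Longrightarrow> proper_mat B \<Longrightarrow> dim_col A = dim_row B \<Longrightarrow>
    mat_inf (A * B) = mat_inf A * mat_inf B"
  unfolding proper_mat_iff by (rule rf_inf.hom_mat_mult)

lemma stable_mat_one_minus:
  "stable_mat A \<Longrightarrow> A \<in> carrier_mat n n \<Longrightarrow> stable_mat (1\<^sub>m n - A)"
  unfolding stable_mat_iff
  by (rule rf_stable.mat_over_minus[OF rf_stable.mat_over_one]) auto

lemma mat_inf_one_minus:
  "proper_mat A \<Longrightarrow> A \<in> carrier_mat n n \<Longrightarrow> mat_inf (1\<^sub>m n - A) = 1\<^sub>m n - mat_inf A"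
  unfolding proper_mat_iff
  by (subst rf_inf.hom_mat_minus[OF rf_inf.mat_over_one]) (auto simp: rf_inf.hom_mat_one)

abbreviation const_mat :: "real mat \<Rightarrow> ratfun mat" where
  "const_mat \<equiv> map_mat rf_const"

lemma stable_const_mat: "stable_mat (const_mat A)"
  by (simp add: stable_mat_def rf_stable_const)

lemma mat_inf_const_mat: "mat_inf (const_mat A) = A"
  by (intro eq_matI) (simp_all add: rf_inf_const)

lemma const_mat_mult: "dim_col A = dim_row B \<Longrightarrow> const_mat (A * B) = const_mat A * const_mat B"
  by (rule rf_const.hom_mat_mult) (auto simp: rf_const.mat_over_def)

lemma const_mat_one: "const_mat (1\<^sub>m n) = 1\<^sub>m n"
  by (rule rf_const.hom_mat_one)

abbreviation circle_mat :: "real \<Rightarrow> ratfun mat \<Rightarrow> complex mat" where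
  "circle_mat \<omega> \<equiv> map_mat (\<lambda>f. rf_eval f (cis \<omega>))"

lemma circle_mat_mult:
  assumes "stable_mat A" "stable_mat B" "dim_col A = dim_row B"
  shows "circle_mat \<omega> (A * B) = circle_mat \<omega> A * circle_mat \<omega> B"
proof -
  interpret partial_ring_hom "Collect rf_stable" "\<lambda>f. rf_eval f (cis \<omega>)"
    by (rule rf_eval_hom) simp
  show ?thesis using assms unfolding stable_mat_iff by (rule hom_mat_mult)
qed

lemma circle_mat_one: "circle_mat \<omega> (1\<^sub>m n) = 1\<^sub>m n"
proof -
  interpret partial_ring_hom "Collect rf_stable" "\<lambda>f. rf_eval f (cis \<omega>)"
    by (rule rf_eval_hom) simp
  show ?thesis by (rule hom_mat_one)
qed

lemma circle_mat_const: "circle_mat \<omega> (const_mat A) = map_mat complex_of_real A"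
  by (intro eq_matI) (simp_all add: rf_eval_const)

text \<open>The difference vanishes on the circle and is thus its own reflection, so it is constant,
  and its value at 1 is 0.\<close>

lemma stable_eqI_circle:
  assumes "rf_stable f" "rf_stable g" "\<And>\<omega>. rf_eval f (cis \<omega>) = rf_eval g (cis \<omega>)"
  shows "f = g"
proof -
  have st: "rf_stable (f - g)" using rf_stable.minus_closed[of f g] assms by simp
  have z: "rf_eval (f - g) (cis \<omega>) = 0" for \<omega>
  proof -
    interpret partial_ring_hom "Collect rf_stable" "\<lambda>f. rf_eval f (cis \<omega>)"
      by (rule rf_eval_hom) simp
    show ?thesis using hom_minus[of f g] assms by simp
  qed
  obtain k where k: "f - g = rf_const k"
    using stable_reflection_const[OF st st] z by auto
  then have "k = 0" using z[of 0] by (simp add: rf_eval_const)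
  then show ?thesis using k by (simp add: rf_const.hom_zero)
qed

lemma stable_mat_eqI_circle:
  assumes "stable_mat A" "stable_mat B" "dim_row A = dim_row B" "dim_col A = dim_col B"
    and "\<And>\<omega>. circle_mat \<omega> A = circle_mat \<omega> B"
  shows "A = B"
proof (rule eq_matI)
  fix i j assume ij: "i < dim_row B" "j < dim_col B"
  have "rf_eval (A $$ (i, j)) (cis \<omega>) = rf_eval (B $$ (i, j)) (cis \<omega>)" for \<omega>
    using arg_cong[OF assms(5)[of \<omega>], of "\<lambda>C. C $$ (i, j)"] ij assms(3,4) by simp
  then show "A $$ (i, j) = B $$ (i, j)"
    using assms ij by (intro stable_eqI_circle) (auto simp: stable_mat_def)
qed (use assms in auto)

lemma mat_assoc: "dim_col A = dim_row B \<Longrightarrow> dim_col B = dim_row C \<Longrightarrow> A * B * C = A * (B * C)"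
  for A B C :: "'a::semiring_0 mat"
  by (rule assoc_mult_mat[of _ "dim_row A" "dim_row B" _ "dim_col B" _ "dim_col C"]) auto

lemma mat_adjoint_index:
  fixes A :: "complex mat"
  shows "dim_row (mat_adjoint A) = dim_col A" "dim_col (mat_adjoint A) = dim_row A"
    "i < dim_col A \<Longrightarrow> j < dim_row A \<Longrightarrow> mat_adjoint A $$ (i, j) = cnj (A $$ (j, i))"
  by (simp_all add: mat_adjoint_def mat_of_rows_def)

lemma mat_adjoint_mult:
  fixes A :: "complex mat"
  assumes "dim_col A = dim_row B"
  shows "mat_adjoint (A * B) = mat_adjoint B * mat_adjoint A"
  using assms
  by (intro eq_matI) (auto simp: mat_adjoint_index scalar_prod_def mult.commute)

lemma mat_adjoint_one: "mat_adjoint (1\<^sub>m n :: complex mat) = 1\<^sub>m n"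
  by (intro eq_matI) (auto simp: mat_adjoint_index)

text \<open>The matrix \<open>F\<close> is \<open>D0 T1 N1\<close>; on the circle it equals \<open>N0 (D1 T0)\<^sup>*\<close>, so it is constant by
  reflection.\<close>

lemma spectral_factors_differ_by_const:
  assumes dims: "T0 \<in> carrier_mat n p" "T1 \<in> carrier_mat n p"
      "D0 \<in> carrier_mat p n" "D1 \<in> carrier_mat p n"
      "N0 \<in> carrier_mat p p" "N1 \<in> carrier_mat p p"
    and stable: "stable_mat T0" "stable_mat T1" "stable_mat D0" "stable_mat D1"
    and inv: "D0 * T0 = 1\<^sub>m p" "D1 * T1 = 1\<^sub>m p"
    and sym: "transpose_mat N0 = N0"
    and spec: "\<And>\<omega>. circle_mat \<omega> T1 * map_mat complex_of_real N1 * mat_adjoint (circle_mat \<omega> T1)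
      = circle_mat \<omega> T0 * map_mat complex_of_real N0 * mat_adjoint (circle_mat \<omega> T0)"
  obtains F where "F \<in> carrier_mat p p" "T1 * const_mat N1 = T0 * const_mat F"
    "D0 * T1 * const_mat N1 = const_mat F"
    "map_mat complex_of_real F * mat_adjoint (circle_mat \<omega> (D0 * T1)) = map_mat complex_of_real N0"
proof -
  let ?E = circle_mat and ?c = "map_mat complex_of_real"
  have d: "dim_row T0 = n" "dim_row T1 = n" "dim_row D0 = p" "dim_row D1 = p" "dim_row N0 = p" "dim_row N1 = p"
    "dim_col T0 = p" "dim_col T1 = p" "dim_col D0 = n" "dim_col D1 = n" "dim_col N0 = p" "dim_col N1 = p"
    using dims by auto
  note dd = d mat_adjoint_index(1,2)
  have E1: "?E \<omega> D0 * ?E \<omega> T0 = 1\<^sub>m p" "?E \<omega> D1 * ?E \<omega> T1 = 1\<^sub>m p" for \<omega>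
    using circle_mat_mult[of D0 T0 \<omega>] circle_mat_mult[of D1 T1 \<omega>] stable inv d circle_mat_one[of \<omega> p] by auto
  have A1: "mat_adjoint (?E \<omega> T1) * mat_adjoint (?E \<omega> D1) = 1\<^sub>m p"
    "mat_adjoint (?E \<omega> T0) * mat_adjoint (?E \<omega> D0) = 1\<^sub>m p" for \<omega>
    using d by (simp_all only: E1 mat_adjoint_one index_map_mat mat_adjoint_mult[symmetric])
  define X where "X = D0 * T1"
  define Y where "Y = D1 * T0"
  have X: "dim_row X = p" "dim_col X = p" "stable_mat X" and Y: "dim_row Y = p" "dim_col Y = p" "stable_mat Y"
    using stable d by (simp_all add: X_def Y_def stable_mat_mult)
  have EX: "?E \<omega> X = ?E \<omega> D0 * ?E \<omega> T1" and EY: "?E \<omega> Y = ?E \<omega> D1 * ?E \<omega> T0" for \<omega>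
    using stable d by (simp_all add: X_def Y_def circle_mat_mult)
  \<comment> \<open>Inserting the identity from \<open>A1\<close> on the right creates the spectrum
    of \<open>T1\<close>, which \<open>spec\<close> exchanges for that of \<open>T0\<close>.\<close>
  have one: "?E \<omega> T1 * ?c N1 = ?E \<omega> T0 * (?c N0 * mat_adjoint (?E \<omega> Y))" for \<omega>
  proof -
    have "?E \<omega> T1 * ?c N1 = ?E \<omega> T1 * ?c N1 * (mat_adjoint (?E \<omega> T1) * mat_adjoint (?E \<omega> D1))"
      unfolding A1 using d by (intro right_mult_one_mat'[symmetric]) simp
    also have "\<dots> = (?E \<omega> T1 * ?c N1 * mat_adjoint (?E \<omega> T1)) * mat_adjoint (?E \<omega> D1)"
      using d by (simp add: mat_assoc dd)
    also have "\<dots> = ?E \<omega> T0 * (?c N0 * (mat_adjoint (?E \<omega> T0) * mat_adjoint (?E \<omega> D1)))"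
      unfolding spec using d by (simp add: mat_assoc dd)
    finally show ?thesis unfolding EY using d by (simp add: mat_adjoint_mult)
  qed
  have two: "?E \<omega> X * ?c N1 = ?c N0 * mat_adjoint (?E \<omega> Y)" for \<omega>
  proof -
    have "?E \<omega> X * ?c N1 = ?E \<omega> D0 * (?E \<omega> T1 * ?c N1)"
      unfolding EX using d by (simp add: mat_assoc)
    also have "\<dots> = (?E \<omega> D0 * ?E \<omega> T0) * (?c N0 * mat_adjoint (?E \<omega> Y))"
      unfolding one using d Y by (simp add: mat_assoc dd)
    also have "\<dots> = ?c N0 * mat_adjoint (?E \<omega> Y)"
      unfolding E1 using d by (intro left_mult_one_mat') simp
    finally show ?thesis .
  qed
  \<comment> \<open>By symmetry of \<open>N0\<close>, the product of \<open>N0\<close> with the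
    adjoint of \<open>Y\<close> is the adjoint of \<open>Y * N0\<close>, a stable matrix. This is
    the form in which \<open>stable_reflection_const\<close> applies entrywise.\<close>
  have symN: "N0 $$ (j, i) = N0 $$ (i, j)" if "i < p" "j < p" for i j
    using arg_cong[OF sym, of "\<lambda>A. A $$ (i, j)"] that d by simp
  have "\<exists>k. (X * const_mat N1) $$ (i, j) = rf_const k" if ij: "i < p" "j < p" for i j
  proof -
    have st: "stable_mat (X * const_mat N1)" "stable_mat (Y * const_mat N0)"
      using X Y d by (auto intro!: stable_mat_mult stable_const_mat)
    have "rf_eval ((X * const_mat N1) $$ (i, j)) (cis \<omega>) = cnj (rf_eval ((Y * const_mat N0) $$ (j, i)) (cis \<omega>))" for \<omega>
    proof -
      have "rf_eval ((X * const_mat N1) $$ (i, j)) (cis \<omega>) = ?E \<omega> (X * const_mat N1) $$ (i, j)"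
        using X d ij by simp
      also have "\<dots> = (?c N0 * mat_adjoint (?E \<omega> Y)) $$ (i, j)"
        using X d two[of \<omega>] by (simp add: circle_mat_mult stable_const_mat circle_mat_const)
      also have "\<dots> = cnj ((?E \<omega> Y * ?c N0) $$ (j, i))"
        using Y d ij symN by (auto simp: scalar_prod_def mat_adjoint_index intro!: sum.cong)
      also have "\<dots> = cnj (?E \<omega> (Y * const_mat N0) $$ (j, i))"
        using Y d by (simp add: circle_mat_mult stable_const_mat circle_mat_const)
      finally show ?thesis using Y d ij by simp
    qed
    moreover have "rf_stable ((X * const_mat N1) $$ (i, j))" "rf_stable ((Y * const_mat N0) $$ (j, i))"
      using st X Y d ij by (simp_all add: stable_mat_def)
    ultimately show ?thesis by (meson stable_reflection_const)
  qed
  then have "\<forall>i j. \<exists>k. i < p \<longrightarrow> j < p \<longrightarrow> (X * const_mat N1) $$ (i, j) = rf_const k" by blast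
  then obtain k where k: "\<And>i j. i < p \<Longrightarrow> j < p \<Longrightarrow> (X * const_mat N1) $$ (i, j) = rf_const (k i j)"
    unfolding choice_iff by blast
  define F where "F = mat p p (\<lambda>(i, j). k i j)"
  have F: "F \<in> carrier_mat p p" "dim_row F = p" "dim_col F = p" by (simp_all add: F_def)
  have XF: "X * const_mat N1 = const_mat F"
    by (rule eq_matI) (use X d k in \<open>simp_all add: F_def del: index_mult_mat(1)\<close>)
  have EXF: "?E \<omega> X * ?c N1 = ?c F" for \<omega>
    using arg_cong[OF XF, of "?E \<omega>"] X d by (simp add: circle_mat_mult stable_const_mat circle_mat_const)
  show thesis
  proof (rule that[of F])
    show "F \<in> carrier_mat p p" by fact
    show "D0 * T1 * const_mat N1 = const_mat F" using XF by (simp add: X_def)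
    \<comment> \<open>On the circle, \<open>one\<close> and \<open>two\<close> combine to T1 N1 = T0
      (X N1), and X N1 is the constant F.\<close>
    show "T1 * const_mat N1 = T0 * const_mat F"
    proof (rule stable_mat_eqI_circle)
      fix \<omega>
      show "?E \<omega> (T1 * const_mat N1) = ?E \<omega> (T0 * const_mat F)"
        using one[of \<omega>] two[of \<omega>] EXF[of \<omega>] stable d F
        by (simp add: circle_mat_mult stable_const_mat circle_mat_const)
    qed (use stable d F in \<open>auto intro!: stable_mat_mult stable_const_mat\<close>)
    \<comment> \<open>\<open>D0\<close> and its adjoint applied to the spectrum of
      \<open>T1\<close>, which is that of \<open>T0\<close>, leave \<open>N0\<close>.\<close>
    have "?c F * mat_adjoint (?E \<omega> X) = ?E \<omega> D0 * (?E \<omega> T1 * ?c N1 * mat_adjoint (?E \<omega> T1)) * mat_adjoint (?E \<omega> D0)"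
      unfolding EXF[symmetric, of \<omega>] EX using d by (simp add: mat_assoc dd mat_adjoint_mult)
    also have "\<dots> = (?E \<omega> D0 * ?E \<omega> T0) * (?c N0 * (mat_adjoint (?E \<omega> T0) * mat_adjoint (?E \<omega> D0)))"
      unfolding spec using d by (simp add: mat_assoc dd)
    also have "\<dots> = ?c N0" unfolding E1 A1 using d by simp
    finally show "?c F * mat_adjoint (?E \<omega> (D0 * T1)) = ?c N0" by (simp add: X_def)
  qed
qed

section \<open>Network models\<close>

lemma mult_append_cols:
  fixes A :: "'a::semiring_0 mat"
  assumes "A \<in> carrier_mat m n" "B \<in> carrier_mat n k" "C \<in> carrier_mat n l"
  shows "A * append_cols B C = append_cols (A * B) (A * C)"
  using assms
  by (intro eq_matI) (auto simp: append_cols_def scalar_prod_def)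

lemma append_cols_index:
  "dim_row (append_cols A B) = dim_row A" "dim_col (append_cols A B) = dim_col A + dim_col B"
  "i < dim_row A \<Longrightarrow> j < dim_col A + dim_col B \<Longrightarrow>
    append_cols A B $$ (i, j) = (if j < dim_col A then A $$ (i, j) else B $$ (i, j - dim_col A))"
  by (auto simp: append_cols_def)

lemma append_cols_eqD:
  assumes "append_cols A B = append_cols A' B'"
    "A \<in> carrier_mat m n" "A' \<in> carrier_mat m n" "B \<in> carrier_mat m k" "B' \<in> carrier_mat m k"
  shows "A = A'" "B = B'"
proof -
  have e: "append_cols A B $$ (i, j) = append_cols A' B' $$ (i, j)" for i j using assms by simp
  show "A = A'"
    using assms(2-) e by (intro eq_matI) (auto simp: append_cols_index split: if_splits,
      metis append_cols_index(3) carrier_matD trans_less_add1)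
  show "B = B'"
  proof (rule eq_matI)
    fix i j assume "i < dim_row B'" "j < dim_col B'"
    then show "B $$ (i, j) = B' $$ (i, j)"
      using e[of i "j + n"] assms(2-) by (simp add: append_cols_index)
  qed (use assms in auto)
qed

lemma pos_def_mat_invertible:
  assumes "pos_def_mat n A"
  shows "invertible_mat A"
proof -
  have A: "A \<in> carrier_mat n n" using assms by (simp add: pos_def_mat_def)
  have "det A \<noteq> 0"
  proof
    assume "det A = 0"
    then obtain v where v: "v \<in> carrier_vec n" "v \<noteq> 0\<^sub>v n" "A *\<^sub>v v = 0\<^sub>v n"
      using det_0_iff_vec_prod_zero_field[OF A] by auto
    then have "v \<bullet> (A *\<^sub>v v) = 0" by simp
    then show False using assms v unfolding pos_def_mat_def by (metis less_irrefl)
  qed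
  then have "A \<in> Units (ring_mat TYPE(real) n ())" using A by (rule det_non_zero_imp_unit[rotated])
  then show ?thesis using A
    by (auto simp: Units_def ring_mat_simps invertible_mat_def inverts_mat_def)
qed

lemma pos_def_mat_diag_pos:
  assumes "pos_def_mat n A" "i < n"
  shows "A $$ (i, i) > 0"
proof -
  have A: "A \<in> carrier_mat n n" using assms by (simp add: pos_def_mat_def)
  have "unit_vec n i \<noteq> (0\<^sub>v n :: real vec)"
    using assms(2) by (metis index_unit_vec(1) index_zero_vec(1) zero_neq_one)
  then have "unit_vec n i \<bullet> (A *\<^sub>v unit_vec n i) > 0"
    using assms(1) by (simp add: pos_def_mat_def)
  moreover have "unit_vec n i \<bullet> (A *\<^sub>v unit_vec n i) = A $$ (i, i)"
    using A assms(2) by (simp add: scalar_prod_left_unit)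
  ultimately show ?thesis by simp
qed

section \<open>A single network model: inverse, responses, feedthrough\<close>

locale net =
  fixes L K p :: nat and m :: net_model
  assumes model: "network_model L K p m"
begin

abbreviation "G \<equiv> netG m"
abbreviation "R \<equiv> netR m"
abbreviation "H \<equiv> netH m"
abbreviation "W \<equiv> I_minus_G_inv m"
abbreviation "Lam \<equiv> netLambda m"

lemma p_le_L: "p \<le> L" using model by (simp add: network_model_def)

lemma carr: "G \<in> carrier_mat L L" "R \<in> carrier_mat L K" "H \<in> carrier_mat L p" "Lam \<in> carrier_mat p p"
  using model by (auto simp: network_model_def pos_def_mat_def)

lemma dims [simp]:
  "dim_row G = L" "dim_col G = L" "dim_row R = L" "dim_col R = K" "dim_row H = L" "dim_col H = p"
  "dim_row Lam = p" "dim_col Lam = p"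
  using carr by auto

declare carr [simp]

lemma G_diag: "i < L \<Longrightarrow> G $$ (i, i) = 0"
  using model by (simp add: network_model_def)

lemma stable: "stable_mat G" "stable_mat H" "stable_mat W" "proper_mat R"
  using model by (auto simp: network_model_def)

lemma proper: "proper_mat G" "proper_mat H" "proper_mat W"
  using stable stable_mat_proper by auto

lemma W_carr: "W \<in> carrier_mat L L"
  and W_right: "(1\<^sub>m L - G) * W = 1\<^sub>m L"
  and W_left: "W * (1\<^sub>m L - G) = 1\<^sub>m L"
  using minv[of "1\<^sub>m L - G" L] minus_carrier_mat[OF carr(1), of "1\<^sub>m L"] model
  by (simp_all add: network_model_def I_minus_G_inv_def)

lemma W_dims [simp]: "dim_row W = L" "dim_col W = L"
  using W_carr by auto

declare W_carr [simp]

lemma Twr_carr: "net_Twr m \<in> carrier_mat L K" and Twe_carr: "net_Twe m \<in> carrier_mat L p"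
  by (simp_all add: net_Twr_def net_Twe_def carrier_matI)

lemma T_eq: "net_T m = append_cols (net_Twr m) (net_Twe m)"
  unfolding net_T_def netU_def net_Twr_def net_Twe_def
  by (rule mult_append_cols[OF W_carr carr(2,3)])

lemma U_carr: "netU m \<in> carrier_mat L (K + p)"
  by (simp add: netU_def append_cols_index carrier_matI)

lemma T_carr: "net_T m \<in> carrier_mat L (K + p)"
  unfolding net_T_def by (rule mult_carrier_mat[OF W_carr U_carr])

lemma GT: "(1\<^sub>m L - G) * net_T m = netU m"
proof -
  have "(1\<^sub>m L - G) * net_T m = (1\<^sub>m L - G) * W * netU m"
    using U_carr by (simp add: net_T_def mat_assoc)
  then show ?thesis using U_carr by (simp add: W_right)
qed

lemma Twe_stable: "stable_mat (net_Twe m)"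
  by (simp add: net_Twe_def stable_mat_mult stable)

lemma Twr_proper: "proper_mat (net_Twr m)"
  by (simp add: net_Twr_def proper_mat_mult stable proper)

text \<open>The left inverse is \<open>Hd * (1\<^sub>m L - G)\<close>, stable because the modules
  themselves are.\<close>

lemma T_left_inv:
  obtains D where "D \<in> carrier_mat p L" "stable_mat D" "D * net_Twe m = 1\<^sub>m p"
proof -
  obtain Hd where Hd: "Hd \<in> carrier_mat p L" "stable_mat Hd" "Hd * H = 1\<^sub>m p"
    using model by (auto simp: network_model_def)
  have "Hd * (1\<^sub>m L - G) * net_Twe m = Hd * (((1\<^sub>m L - G) * W) * H)"
    using Hd by (simp add: net_Twe_def mat_assoc)
  also have "\<dots> = 1\<^sub>m p" using Hd by (simp add: W_right)
  finally show thesis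
    using Hd by (intro that[of "Hd * (1\<^sub>m L - G)"])
      (auto intro!: stable_mat_mult stable_mat_one_minus stable)
qed

lemma H_inf_top:
  assumes "i < p" "j < p"
  shows "rf_inf (H $$ (i, j)) = (if i = j then 1 else 0)"
proof -
  have c: "{a. a < L \<and> a < p} = {..<p}" using p_le_L by auto
  have card: "{a \<in> {..<p}. a < i} = {..<i}" "{a \<in> UNIV. a < j} = {..<j}" using assms by auto
  have "submatrix H {..<p} UNIV $$ (i, j) = H $$ (i, j)"
    using submatrix_index_card[of i H j "{..<p}" UNIV] assms p_le_L unfolding card by simp
  moreover have "mat_inf (submatrix H {..<p} UNIV) $$ (i, j) = 1\<^sub>m p $$ (i, j)"
    using model by (simp add: network_model_def)
  moreover have "i < dim_row (submatrix H {..<p} UNIV)" "j < dim_col (submatrix H {..<p} UNIV)"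
    using assms by (simp_all add: dim_submatrix c)
  ultimately show ?thesis using assms by simp
qed

text \<open>The upper block of \<open>mat_inf H\<close> is the identity, so multiplication by it
  loses no information: \<open>A\<close> reappears in the first p rows.\<close>

lemma inf_H_mult_top:
  assumes "i < p" "j < q" "A \<in> carrier_mat p q"
  shows "(mat_inf H * A) $$ (i, j) = A $$ (i, j)"
proof -
  have i: "i < L" using assms p_le_L by simp
  have "(mat_inf H * A) $$ (i, j) = (\<Sum>k<p. rf_inf (H $$ (i, k)) * A $$ (k, j))"
    using assms i by (simp add: scalar_prod_def atLeast0LessThan)
  also have "\<dots> = (\<Sum>k<p. if k = i then A $$ (k, j) else 0)"
    using assms by (intro sum.cong) (auto simp: H_inf_top)
  finally show ?thesis using assms by simp
qed

lemma inf_W: "(1\<^sub>m L - mat_inf G) * mat_inf W = 1\<^sub>m L" "mat_inf W * (1\<^sub>m L - mat_inf G) = 1\<^sub>m L"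
proof -
  have p: "proper_mat (1\<^sub>m L - G)"
    by (intro stable_mat_proper stable_mat_one_minus stable carr)
  show "(1\<^sub>m L - mat_inf G) * mat_inf W = 1\<^sub>m L"
    using mat_inf_mult[OF p proper(3)] by (simp add: W_right mat_inf_one_minus[OF proper(1)] rf_inf.hom_mat_one)
  show "mat_inf W * (1\<^sub>m L - mat_inf G) = 1\<^sub>m L"
    using mat_inf_mult[OF proper(3) p] by (simp add: W_left mat_inf_one_minus[OF proper(1)] rf_inf.hom_mat_one)
qed

lemma inf_Twe: "mat_inf (net_Twe m) = mat_inf W * mat_inf H"
  by (simp add: net_Twe_def mat_inf_mult proper)

lemma inf_G_Twe: "(1\<^sub>m L - mat_inf G) * mat_inf (net_Twe m) = mat_inf H"
  by (simp add: inf_Twe mat_assoc[symmetric] inf_W)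

lemma inf_G_Twr: "(1\<^sub>m L - mat_inf G) * mat_inf (net_Twr m) = mat_inf R"
  by (simp add: net_Twr_def mat_inf_mult proper stable mat_assoc[symmetric] inf_W)

lemma Lam_sym: "transpose_mat Lam = Lam" and Lam_pos: "i < p \<Longrightarrow> Lam $$ (i, i) > 0"
  and Lam_inv: "invertible_mat Lam"
  using model pos_def_mat_diag_pos[of p Lam] pos_def_mat_invertible[of p Lam]
  by (auto simp: network_model_def pos_def_mat_def)

end

text \<open>The factors of the noise spectrum agree up to \<open>F\<close>; the feedthrough conditions serve
  to pin down \<open>F\<close>.\<close>

lemma noise_factor_unique:
  assumes m0: "network_model L K p m0" and m1: "network_model L K p m1"
    and Phi: "net_Phi m1 = net_Phi m0"
    and feed: "\<And>F X. F \<in> carrier_mat p p \<Longrightarrow>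
      mat_inf (net_Twe m1) * netLambda m1 = mat_inf (net_Twe m0) * F \<Longrightarrow>
      X \<in> carrier_mat p p \<Longrightarrow>
      X * map_mat complex_of_real (netLambda m1) = map_mat complex_of_real F \<Longrightarrow>
      map_mat complex_of_real F * mat_adjoint X = map_mat complex_of_real (netLambda m0) \<Longrightarrow>
      F = netLambda m1"
  shows "net_Twe m1 = net_Twe m0" "netLambda m1 = netLambda m0"
proof -
  interpret n0: net L K p m0 by unfold_locales (rule m0)
  interpret n1: net L K p m1 by unfold_locales (rule m1)
  let ?T0 = "net_Twe m0" and ?T1 = "net_Twe m1"
  obtain D0 where D0: "D0 \<in> carrier_mat p L" "stable_mat D0" "D0 * ?T0 = 1\<^sub>m p" by (rule n0.T_left_inv)
  obtain D1 where D1: "D1 \<in> carrier_mat p L" "stable_mat D1" "D1 * ?T1 = 1\<^sub>m p" by (rule n1.T_left_inv)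
  have d: "dim_row ?T0 = L" "dim_col ?T0 = p" "dim_row ?T1 = L" "dim_col ?T1 = p" "dim_row D0 = p" "dim_col D0 = L"
    using n0.Twe_carr n1.Twe_carr D0 by auto
  obtain F where F: "F \<in> carrier_mat p p" "?T1 * const_mat n1.Lam = ?T0 * const_mat F"
    "D0 * ?T1 * const_mat n1.Lam = const_mat F"
    "map_mat complex_of_real F * mat_adjoint (circle_mat 0 (D0 * ?T1)) = map_mat complex_of_real n0.Lam"
  \<comment> \<open>The angle 0 stands for an arbitrary point of the circle: \<open>feed\<close>
    asks for its relations on \<open>X\<close> at one point.\<close>
  proof (rule spectral_factors_differ_by_const[of ?T0 L p ?T1 D0 D1 n0.Lam n1.Lam 0])
    show "circle_mat \<omega> ?T1 * map_mat complex_of_real n1.Lam * mat_adjoint (circle_mat \<omega> ?T1)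
      = circle_mat \<omega> ?T0 * map_mat complex_of_real n0.Lam * mat_adjoint (circle_mat \<omega> ?T0)" for \<omega>
      using fun_cong[OF Phi, of \<omega>] by (simp add: net_Phi_def Let_def)
  qed (use D0 D1 n0.Twe_carr n1.Twe_carr n0.Twe_stable n1.Twe_stable n0.Lam_sym in simp_all)
  have dF: "dim_row F = p" "dim_col F = p" using F(1) by auto
  have st: "stable_mat (D0 * ?T1)"
    using D0 d n1.Twe_stable by (simp add: stable_mat_mult)
  have "mat_inf ?T1 * n1.Lam = mat_inf (?T1 * const_mat n1.Lam)"
    using d by (subst mat_inf_mult)
      (simp_all add: stable_mat_proper n1.Twe_stable stable_const_mat mat_inf_const_mat)
  also have "\<dots> = mat_inf (?T0 * const_mat F)" unfolding F(2) ..
  also have "\<dots> = mat_inf ?T0 * F"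
    using d dF by (subst mat_inf_mult)
      (simp_all add: stable_mat_proper n0.Twe_stable stable_const_mat mat_inf_const_mat)
  finally have inf: "mat_inf ?T1 * n1.Lam = mat_inf ?T0 * F" .
  have X: "circle_mat 0 (D0 * ?T1) \<in> carrier_mat p p" by (rule carrier_matI) (simp_all only: d index_map_mat index_mult_mat)
  have "circle_mat 0 (D0 * ?T1) * map_mat complex_of_real n1.Lam = circle_mat 0 (D0 * ?T1 * const_mat n1.Lam)"
    using d st by (subst circle_mat_mult) (simp_all add: stable_const_mat circle_mat_const del: cis_zero)
  also have "\<dots> = map_mat complex_of_real F" unfolding F(3) circle_mat_const ..
  finally have XL: "circle_mat 0 (D0 * ?T1) * map_mat complex_of_real n1.Lam = map_mat complex_of_real F" .
  have FL: "F = n1.Lam" by (rule feed[OF F(1) inf X XL F(4)])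
  \<comment> \<open>What remains is T1 Lam1 = T0 Lam1, and the positive definite Lam1 can be
    cancelled.\<close>
  define N where "N = minv n1.Lam"
  have N: "N \<in> carrier_mat p p" "n1.Lam * N = 1\<^sub>m p" "dim_row N = p"
    using minv[OF n1.carr(4) n1.Lam_inv] by (auto simp: N_def)
  have cN: "const_mat n1.Lam * const_mat N = 1\<^sub>m p"
    using const_mat_mult[of n1.Lam N] N by (simp add: const_mat_one)
  have "?T1 = ?T1 * const_mat n1.Lam * const_mat N" using d N cN by (simp add: mat_assoc)
  also have "\<dots> = ?T0" unfolding F(2) FL using d N cN by (simp add: mat_assoc)
  finally show T: "?T1 = ?T0" .
  \<comment> \<open>Now \<open>D0 * ?T1\<close> is the identity, so the last property of
    \<open>F\<close> compares the two covariances directly.\<close>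
  have c: "map_mat complex_of_real n1.Lam = map_mat complex_of_real n0.Lam"
    using F(4) unfolding FL T D0(3) circle_mat_one mat_adjoint_one by simp
  have "n1.Lam $$ (i, j) = n0.Lam $$ (i, j)" if "i < p" "j < p" for i j
    using that arg_cong[OF c, of "\<lambda>A. A $$ (i, j)"] by simp
  then show "n1.Lam = n0.Lam" by (intro eq_matI) auto
qed

text \<open>Multiplying by the common I - G at infinity gives H1 Lam1 = H0 F there, and the monic
  upper blocks compare the first p rows.\<close>

lemma feedthrough_equal_G_inf:
  assumes m0: "network_model L K p m0" and m1: "network_model L K p m1"
    and G: "mat_inf (netG m1) = mat_inf (netG m0)"
    and F: "F \<in> carrier_mat p p" "mat_inf (net_Twe m1) * netLambda m1 = mat_inf (net_Twe m0) * F"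
  shows "F = netLambda m1"
proof -
  interpret n0: net L K p m0 by unfold_locales (rule m0)
  interpret n1: net L K p m1 by unfold_locales (rule m1)
  have d: "dim_row (net_Twe m0) = L" "dim_col (net_Twe m0) = p" "dim_row (net_Twe m1) = L" "dim_col (net_Twe m1) = p"
    using n0.Twe_carr n1.Twe_carr by auto
  have "mat_inf n1.H * n1.Lam = (1\<^sub>m L - mat_inf n1.G) * (mat_inf (net_Twe m1) * n1.Lam)"
    using d by (simp add: n1.inf_G_Twe[symmetric] mat_assoc)
  also have "\<dots> = mat_inf n0.H * F"
    unfolding F(2) G using d F(1) by (simp add: n0.inf_G_Twe[symmetric] mat_assoc)
  finally have eq: "mat_inf n1.H * n1.Lam = mat_inf n0.H * F" .
  show ?thesis
  proof (rule eq_matI)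
    fix i j assume "i < dim_row n1.Lam" "j < dim_col n1.Lam"
    then have ij: "i < p" "j < p" "i < L" using n1.p_le_L by auto
    show "F $$ (i, j) = n1.Lam $$ (i, j)"
      using arg_cong[OF eq, of "\<lambda>A. A $$ (i, j)"] n0.inf_H_mult_top[OF ij(1,2) F(1)]
        n1.inf_H_mult_top[OF ij(1,2) n1.carr(4)] by (simp only:)
  qed (use F in auto)
qed

section \<open>Absence of algebraic loops: triangular feedthrough\<close>

lemma index_mult_mat_sum:
  assumes "i < dim_row A" "j < dim_col B" "dim_col A = n" "dim_row B = n"
  shows "(A * B) $$ (i, j) = (\<Sum>k<n. A $$ (i, k) * B $$ (k, j))"
  using assms by (simp add: scalar_prod_def atLeast0LessThan)

lemma permutation_matrix_conj_index:
  assumes "\<sigma> permutes {..<n}" "A \<in> carrier_mat n n" "a < n" "b < n"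
  defines "P \<equiv> mat n n (\<lambda>(i, j). if i = \<sigma> j then 1 else (0::real))"
  shows "(transpose_mat P * A * P) $$ (a, b) = A $$ (\<sigma> a, \<sigma> b)"
proof -
  have s: "\<sigma> a < n" "\<sigma> b < n" using permutes_in_image[OF assms(1)] assms(3,4) by auto
  have PA: "(transpose_mat P * A) $$ (a, k) = A $$ (\<sigma> a, k)" if "k < n" for k
  proof -
    have "(transpose_mat P * A) $$ (a, k) = (\<Sum>l<n. P $$ (l, a) * A $$ (l, k))"
      using assms that by (simp add: scalar_prod_def atLeast0LessThan)
    also have "\<dots> = (\<Sum>l<n. if l = \<sigma> a then A $$ (l, k) else 0)"
      using assms by (intro sum.cong) auto
    finally show ?thesis using s by simp
  qed
  have Pb: "P $$ (k, b) = (if k = \<sigma> b then 1 else 0)" if "k < n" for k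
    using assms(4) that by (simp add: P_def)
  have "(transpose_mat P * A * P) $$ (a, b) = (\<Sum>k<n. (transpose_mat P * A) $$ (a, k) * P $$ (k, b))"
    using assms by (intro index_mult_mat_sum) auto
  also have "\<dots> = (\<Sum>k<n. if k = \<sigma> b then A $$ (\<sigma> a, k) else 0)"
    by (intro sum.cong) (simp_all add: PA Pb del: index_mult_mat)
  finally show ?thesis using s by simp
qed

text \<open>\<open>r\<close> is the position of a node in the ordering given by the permutation, one
  function for all models. The zero diagonal of G improves upper triangular to strictly upper
  triangular.\<close>

lemma no_algebraic_loops_order:
  assumes "permutation_matrix L P"
  obtains r :: "nat \<Rightarrow> nat" where "inj r"
    "\<And>m i j. network_model L K p m \<Longrightarrow> req_C2 P m \<Longrightarrow> i < L \<Longrightarrow> j < L \<Longrightarrow>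
      mat_inf (netG m) $$ (i, j) \<noteq> 0 \<Longrightarrow> r i < r j"
proof -
  obtain \<sigma> where \<sigma>: "\<sigma> permutes {..<L}" "P = mat L L (\<lambda>(i, j). if i = \<sigma> j then 1 else 0)"
    using assms by (auto simp: permutation_matrix_def)
  define r where "r = inv_into UNIV \<sigma>"
  have r: "r permutes {..<L}" using \<sigma>(1) by (simp add: r_def permutes_inv)
  show thesis
  proof (rule that)
    show "inj r" using r by (rule permutes_inj)
    fix m i j
    assume m: "network_model L K p m" and req: "req_C2 P m" and ij: "i < L" "j < L"
      and nz: "mat_inf (netG m) $$ (i, j) \<noteq> 0"
    interpret net L K p m by unfold_locales (rule m)
    have rl: "r i < L" "r j < L" using permutes_in_image[OF r] ij by auto
    have s: "\<sigma> (r i) = i" "\<sigma> (r j) = j"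
      using permutes_inverses(1)[OF \<sigma>(1)] by (simp_all add: r_def)
    have e: "(transpose_mat P * mat_inf G * P) $$ (r i, r j) = mat_inf G $$ (i, j)"
      using permutation_matrix_conj_index[OF \<sigma>(1), of "mat_inf G" "r i" "r j"] rl s
      by (simp add: \<sigma>(2))
    have "upper_triangular (transpose_mat P * mat_inf G * P)" using req by (simp add: req_C2_def)
    moreover have "dim_row (transpose_mat P * mat_inf G * P) = L" by (simp add: \<sigma>(2))
    ultimately have "\<not> r j < r i"
      using upper_triangularD[of _ "r j" "r i"] e nz rl by metis
    moreover have "i \<noteq> j" using nz ij G_diag by (auto simp: rf_inf.hom_zero)
    then have "r i \<noteq> r j" using s by metis
    ultimately show "r i < r j" by simp
  qed
qed

lemma mult_one_minus_index:
  fixes W A :: "'a::comm_ring_1 mat"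
  assumes "W \<in> carrier_mat k n" "A \<in> carrier_mat n n" "i < k" "j < n"
  shows "(W * (1\<^sub>m n - A)) $$ (i, j) = W $$ (i, j) - (\<Sum>l<n. W $$ (i, l) * A $$ (l, j))"
proof -
  have "(W * (1\<^sub>m n - A)) $$ (i, j)
      = (\<Sum>l<n. (if l = j then W $$ (i, l) else 0) - W $$ (i, l) * A $$ (l, j))"
    using assms by (auto simp: scalar_prod_def atLeast0LessThan algebra_simps intro!: sum.cong)
  then show ?thesis using assms by (simp add: sum_subtractf)
qed

lemma one_minus_mult_index:
  fixes W A :: "'a::comm_ring_1 mat"
  assumes "A \<in> carrier_mat n n" "W \<in> carrier_mat n k" "i < n" "j < k"
  shows "((1\<^sub>m n - A) * W) $$ (i, j) = W $$ (i, j) - (\<Sum>l<n. A $$ (i, l) * W $$ (l, j))"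
proof -
  have "((1\<^sub>m n - A) * W) $$ (i, j)
      = (\<Sum>l<n. (if l = i then W $$ (l, j) else 0) - A $$ (i, l) * W $$ (l, j))"
    using assms by (auto simp: scalar_prod_def atLeast0LessThan algebra_simps intro!: sum.cong)
  then show ?thesis using assms by (simp add: sum_subtractf)
qed

text \<open>In W = I + W A, a nonzero \<open>A $$ (k, j)\<close> forces
  \<open>r k < r j \<le> r i\<close>, and there \<open>W $$ (i, k)\<close> is 0 by induction on the
  position of the column.\<close>

lemma inverse_one_minus_triangular:
  fixes W A :: "'a::comm_ring_1 mat" and r :: "nat \<Rightarrow> nat"
  assumes "W \<in> carrier_mat n n" "A \<in> carrier_mat n n" "W * (1\<^sub>m n - A) = 1\<^sub>m n"
    and tri: "\<And>i j. i < n \<Longrightarrow> j < n \<Longrightarrow> A $$ (i, j) \<noteq> 0 \<Longrightarrow> r i < r j"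
    and "i < n" "j < n" "r j \<le> r i"
  shows "W $$ (i, j) = (if i = j then 1 else 0)"
  using assms(6,7)
proof (induction "r j" arbitrary: j rule: less_induct)
  case less
  have "W $$ (i, k) * A $$ (k, j) = 0" if "k < n" for k
  proof (cases "A $$ (k, j) = 0")
    case False
    then have "r k < r j" using tri that less.prems by blast
    then have "W $$ (i, k) = 0" using less that by auto
    then show ?thesis by simp
  qed simp
  then have "(\<Sum>k<n. W $$ (i, k) * A $$ (k, j)) = 0" by simp
  then have "(W * (1\<^sub>m n - A)) $$ (i, j) = W $$ (i, j)"
    using mult_one_minus_index[OF assms(1,2,5) less.prems(1)] by simp
  then show ?case using assms(3,5) less.prems by simp
qed

text \<open>Two different strictly triangular matrices in the same order, because under (C2) the
  feedthroughs of the two models need not agree; the product of the unit triangular factors is again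
  unit triangular.\<close>

lemma triangular_cross_triangular:
  fixes W A B :: "'a::comm_ring_1 mat" and r :: "nat \<Rightarrow> nat"
  assumes "W \<in> carrier_mat n n" "A \<in> carrier_mat n n" "B \<in> carrier_mat n n" "W * (1\<^sub>m n - A) = 1\<^sub>m n"
    and tri: "\<And>i j. i < n \<Longrightarrow> j < n \<Longrightarrow> A $$ (i, j) \<noteq> 0 \<Longrightarrow> r i < r j"
    and triB: "\<And>i j. i < n \<Longrightarrow> j < n \<Longrightarrow> B $$ (i, j) \<noteq> 0 \<Longrightarrow> r i < r j"
    and ij: "i < n" "j < n" "r j \<le> r i"
  shows "((1\<^sub>m n - B) * W) $$ (i, j) = (if i = j then 1 else 0)"
proof -
  have "B $$ (i, k) * W $$ (k, j) = 0" if "k < n" for k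
  proof (cases "B $$ (i, k) = 0")
    case False
    then have "r i < r k" using triB that ij by blast
    then have "W $$ (k, j) = 0"
      using inverse_one_minus_triangular[where r = r, OF assms(1,2,4) tri that ij(2)] ij by auto
    then show ?thesis by simp
  qed simp
  then have "(\<Sum>k<n. B $$ (i, k) * W $$ (k, j)) = 0" by simp
  then show ?thesis
    using one_minus_mult_index[OF assms(3,1) ij(1,2)]
      inverse_one_minus_triangular[where r = r, OF assms(1,2,4) tri ij] by simp
qed

text \<open>Uniqueness of the triangular (LDL) factorisation, applied to a diagonal matrix.\<close>

lemma triangular_factor_of_diagonal:
  fixes f x :: "nat \<Rightarrow> nat \<Rightarrow> complex" and r :: "nat \<Rightarrow> nat" and l :: "nat \<Rightarrow> complex"
  assumes "inj r"
    and tri: "\<And>i j. i < n \<Longrightarrow> j < n \<Longrightarrow> r j \<le> r i \<Longrightarrow> f i j = (if i = j then l j else 0)"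
    and nz: "\<And>i. i < n \<Longrightarrow> l i \<noteq> 0"
    and x: "\<And>i j. i < n \<Longrightarrow> j < n \<Longrightarrow> x i j * l j = f i j"
    and diag: "\<And>i j. i < n \<Longrightarrow> j < n \<Longrightarrow> i \<noteq> j \<Longrightarrow> (\<Sum>k<n. f i k * cnj (x j k)) = 0"
    and ij: "i < n" "j < n"
  shows "f i j = (if i = j then l j else 0)"
proof -
  have "f i j = 0" if "i < n" "j < n" "r i < r j" for i j
    using that
  \<comment> \<open>Columns are treated from the last position to the first, hence the distance to
    the maximum as measure.\<close>
  proof (induction "Max (r ` {..<n}) - r j" arbitrary: i j rule: less_induct)
    case less
    have le: "r k \<le> Max (r ` {..<n})" if "k < n" for k using that by simp
    \<comment> \<open>Of the sum in \<open>diag\<close> only the term k = j survives: later columns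
      of \<open>f\<close> vanish by induction, and for the remaining k triangularity makes
      \<open>x j k\<close> a Kronecker delta.\<close>
    have "f i k * cnj (x j k) = (if k = j then f i k else 0)" if k: "k < n" for k
    proof (cases "r j < r k")
      case True
      then have "Max (r ` {..<n}) - r k < Max (r ` {..<n}) - r j" using le[OF k] by linarith
      then have "f i k = 0" using less.hyps[of k i] less.prems k True by simp
      then show ?thesis using True by auto
    next
      case False
      then have "f j k = (if j = k then l k else 0)" using tri less.prems k by auto
      then have "x j k = (if j = k then 1 else 0)" using x[OF less.prems(2) k] nz[OF k] by (auto split: if_splits)
      then show ?thesis by auto
    qed
    then have "(\<Sum>k<n. f i k * cnj (x j k)) = (\<Sum>k<n. if k = j then f i k else 0)"
      by (intro sum.cong) auto
    also have "\<dots> = f i j" using less.prems by simp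
    finally show ?case using diag[of i j] less.prems by auto
  qed
  moreover have "i \<noteq> j \<Longrightarrow> r i < r j \<or> r j < r i"
    using \<open>inj r\<close> by (metis injD linorder_neqE_nat)
  ultimately show ?thesis using tri[of i j] ij by (cases "r j \<le> r i") auto
qed

context net begin

text \<open>The first p rows of \<open>mat_inf H\<close> are the identity, so the first p columns of
  the diagonal product are \<open>mat_inf H * Lam\<close>. Its upper block shows that
  \<open>Lam\<close> is diagonal; positive diagonal entries then clear the lower block of
  \<open>mat_inf H\<close>.\<close>

lemma diagonal_noise_feedthrough:
  assumes "diagonal_mat (mat_inf H * Lam * transpose_mat (mat_inf H))"
  shows "i < p \<Longrightarrow> j < p \<Longrightarrow> i \<noteq> j \<Longrightarrow> Lam $$ (i, j) = 0"
    and "i < L \<Longrightarrow> j < p \<Longrightarrow> mat_inf H $$ (i, j) = (if i = j then 1 else 0)"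
proof -
  have e: "(mat_inf H * Lam) $$ (i, j) = (mat_inf H * Lam * transpose_mat (mat_inf H)) $$ (i, j)"
    if ij: "i < L" "j < p" for i j
  proof -
    have j: "j < L" using ij p_le_L by simp
    have "(mat_inf H * Lam * transpose_mat (mat_inf H)) $$ (i, j)
      = (\<Sum>k<p. (mat_inf H * Lam) $$ (i, k) * rf_inf (H $$ (j, k)))"
      using ij j by (simp add: scalar_prod_def atLeast0LessThan)
    also have "\<dots> = (\<Sum>k<p. if k = j then (mat_inf H * Lam) $$ (i, k) else 0)"
      using ij by (intro sum.cong) (auto simp: H_inf_top)
    finally show ?thesis using ij by simp
  qed
  have z: "(mat_inf H * Lam) $$ (i, j) = 0" if "i < L" "j < p" "i \<noteq> j" for i j
    using assms that e[OF that(1,2)] p_le_L by (simp add: diagonal_mat_def)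
  show off: "Lam $$ (i, j) = 0" if "i < p" "j < p" "i \<noteq> j" for i j
    using z[of i j] inf_H_mult_top[of i j p Lam] that p_le_L by simp
  show "mat_inf H $$ (i, j) = (if i = j then 1 else 0)" if ij: "i < L" "j < p" for i j
  proof (cases "i < p")
    case True
    then show ?thesis using H_inf_top ij by simp
  next
    case False
    have "(mat_inf H * Lam) $$ (i, j) = (\<Sum>k<p. mat_inf H $$ (i, k) * Lam $$ (k, j))"
      using ij by (simp add: scalar_prod_def atLeast0LessThan)
    also have "\<dots> = (\<Sum>k<p. if k = j then mat_inf H $$ (i, k) * Lam $$ (k, j) else 0)"
      using ij off by (intro sum.cong) auto
    also have "\<dots> = mat_inf H $$ (i, j) * Lam $$ (j, j)" using ij by simp
    finally show ?thesis using z[of i j] ij False Lam_pos[of j] by auto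
  qed
qed

end

text \<open>The matrix A = (I - G0)(I - G1)^-1 at infinity is unit triangular, and \<open>F\<close>
  is its leading p by p block times the diagonal Lam1. The relations on \<open>X\<close> say that F
  Lam1^-1 times the adjoint of F is the diagonal matrix Lam0, so \<open>F\<close> is diagonal by LDL
  uniqueness.\<close>

lemma feedthrough_no_algebraic_loops:
  assumes m0: "network_model L K p m0" and m1: "network_model L K p m1"
    and P: "permutation_matrix L P" "req_C2 P m0" "req_C2 P m1"
    and F: "F \<in> carrier_mat p p" "mat_inf (net_Twe m1) * netLambda m1 = mat_inf (net_Twe m0) * F"
    and X: "X \<in> carrier_mat p p"
      "X * map_mat complex_of_real (netLambda m1) = map_mat complex_of_real F"
      "map_mat complex_of_real F * mat_adjoint X = map_mat complex_of_real (netLambda m0)"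
  shows "F = netLambda m1"
proof -
  interpret n0: net L K p m0 by unfold_locales (rule m0)
  interpret n1: net L K p m1 by unfold_locales (rule m1)
  have d: "dim_row (net_Twe m0) = L" "dim_col (net_Twe m0) = p" "dim_row (net_Twe m1) = L" "dim_col (net_Twe m1) = p"
    "dim_row F = p" "dim_col F = p" "dim_row X = p" "dim_col X = p"
    using n0.Twe_carr n1.Twe_carr F(1) X(1) by auto
  obtain r :: "nat \<Rightarrow> nat" where r: "inj r" and
    tri: "\<And>m i j. network_model L K p m \<Longrightarrow> req_C2 P m \<Longrightarrow> i < L \<Longrightarrow> j < L \<Longrightarrow>
      mat_inf (netG m) $$ (i, j) \<noteq> 0 \<Longrightarrow> r i < r j"
    using no_algebraic_loops_order[OF P(1), of K p] by blast
  have d0: "diagonal_mat (mat_inf n0.H * n0.Lam * transpose_mat (mat_inf n0.H))"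
    and d1: "diagonal_mat (mat_inf n1.H * n1.Lam * transpose_mat (mat_inf n1.H))"
    using P by (simp_all add: req_C2_def)
  define A where "A = (1\<^sub>m L - mat_inf n0.G) * mat_inf n1.W"
  have A: "dim_row A = L" "dim_col A = L" by (simp_all add: A_def)
  have "A * (mat_inf n1.H * n1.Lam) = (1\<^sub>m L - mat_inf n0.G) * (mat_inf (net_Twe m1) * n1.Lam)"
    by (simp add: A_def n1.inf_Twe mat_assoc)
  also have "\<dots> = mat_inf n0.H * F"
    unfolding F(2) using d by (simp add: n0.inf_G_Twe[symmetric] mat_assoc)
  finally have eq: "A * (mat_inf n1.H * n1.Lam) = mat_inf n0.H * F" .
  have HL: "(mat_inf n1.H * n1.Lam) $$ (k, j) = (if k = j then n1.Lam $$ (j, j) else 0)"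
    if "k < L" "j < p" for k j
  proof -
    have "(mat_inf n1.H * n1.Lam) $$ (k, j) = (\<Sum>l<p. mat_inf n1.H $$ (k, l) * n1.Lam $$ (l, j))"
      using that by (simp add: scalar_prod_def atLeast0LessThan)
    also have "\<dots> = (\<Sum>l<p. if l = j then mat_inf n1.H $$ (k, l) * n1.Lam $$ (l, j) else 0)"
      using that n1.diagonal_noise_feedthrough(1)[OF d1] by (intro sum.cong) auto
    finally show ?thesis using that n1.diagonal_noise_feedthrough(2)[OF d1 that] by simp
  qed
  have FA: "F $$ (i, j) = A $$ (i, j) * n1.Lam $$ (j, j)" if ij: "i < p" "j < p" for i j
  proof -
    have L: "i < L" "j < L" using ij n0.p_le_L by auto
    have "F $$ (i, j) = (A * (mat_inf n1.H * n1.Lam)) $$ (i, j)"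
      unfolding eq using n0.inf_H_mult_top[OF ij F(1)] by simp
    also have "\<dots> = (\<Sum>k<L. A $$ (i, k) * (mat_inf n1.H * n1.Lam) $$ (k, j))"
      using L ij A by (simp add: scalar_prod_def atLeast0LessThan)
    also have "\<dots> = (\<Sum>k<L. if k = j then A $$ (i, k) * n1.Lam $$ (j, j) else 0)"
      using ij by (intro sum.cong) (auto simp del: index_mult_mat simp: HL)
    finally show ?thesis using L by simp
  qed
  have Ftri: "F $$ (i, j) = (if i = j then n1.Lam $$ (j, j) else 0)" if "i < p" "j < p" "r j \<le> r i" for i j
  proof -
    have "A $$ (i, j) = (if i = j then 1 else 0)"
      unfolding A_def
      by (rule triangular_cross_triangular[where r = r and A = "mat_inf n1.G"])
        (use that n0.p_le_L tri[OF m0 P(2)] tri[OF m1 P(3)] n1.inf_W(2) in auto)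
    then show ?thesis using FA that by simp
  qed
  show ?thesis
  proof (rule eq_matI)
    fix i j assume "i < dim_row n1.Lam" "j < dim_col n1.Lam"
    then have ij: "i < p" "j < p" by auto
    have "complex_of_real (F $$ (i, j)) = (if i = j then complex_of_real (n1.Lam $$ (j, j)) else 0)"
    proof (rule triangular_factor_of_diagonal[where r = r and n = p and x = "\<lambda>i j. X $$ (i, j)"])
      show "complex_of_real (F $$ (i, j)) = (if i = j then complex_of_real (n1.Lam $$ (j, j)) else 0)"
        if "i < p" "j < p" "r j \<le> r i" for i j using Ftri that by simp
      show "complex_of_real (n1.Lam $$ (i, i)) \<noteq> 0" if "i < p" for i
        using n1.Lam_pos[OF that] by simp
      show "X $$ (i, j) * complex_of_real (n1.Lam $$ (j, j)) = complex_of_real (F $$ (i, j))"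
        if ij: "i < p" "j < p" for i j
      proof -
        have "complex_of_real (F $$ (i, j)) = (X * map_mat complex_of_real n1.Lam) $$ (i, j)"
          unfolding X(2) using ij d by simp
        also have "\<dots> = (\<Sum>k<p. X $$ (i, k) * complex_of_real (n1.Lam $$ (k, j)))"
          using ij d by (simp add: scalar_prod_def atLeast0LessThan)
        also have "\<dots> = (\<Sum>k<p. if k = j then X $$ (i, k) * complex_of_real (n1.Lam $$ (k, j)) else 0)"
          using ij n1.diagonal_noise_feedthrough(1)[OF d1] by (intro sum.cong) auto
        finally show ?thesis using ij by simp
      qed
      show "(\<Sum>k<p. complex_of_real (F $$ (i, k)) * cnj (X $$ (j, k))) = 0" if "i < p" "j < p" "i \<noteq> j" for i j
      proof -
        have "(\<Sum>k<p. complex_of_real (F $$ (i, k)) * cnj (X $$ (j, k)))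
          = (map_mat complex_of_real F * mat_adjoint X) $$ (i, j)"
          using that d by (simp add: scalar_prod_def atLeast0LessThan mat_adjoint_index)
        also have "\<dots> = 0" unfolding X(3) using that n0.diagonal_noise_feedthrough(1)[OF d0] by simp
        finally show ?thesis .
      qed
    qed (use r ij in auto)
    then have "F $$ (i, j) = (if i = j then n1.Lam $$ (j, j) else 0)" by (auto split: if_splits)
    then show "F $$ (i, j) = n1.Lam $$ (i, j)" using n1.diagonal_noise_feedthrough(1)[OF d1 ij] by auto
  qed (use d in auto)
qed

section \<open>Full row rank of submatrices\<close>

lemma bij_betw_pick:
  assumes "finite I"
  shows "bij_betw (pick I) {..<card I} I"
proof -
  have sub: "pick I ` {..<card I} \<subseteq> I" using pick_in_set_le by auto
  have "I \<subseteq> pick I ` {..<card I}"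
  proof
    fix k assume k: "k \<in> I"
    have "{a \<in> I. a < k} \<subset> I" using k by auto
    then have "card {a \<in> I. a < k} < card I" using assms by (rule psubset_card_mono[rotated])
    then show "k \<in> pick I ` {..<card I}"
      by (intro image_eqI[of k _ "card {a \<in> I. a < k}"]) (simp_all add: pick_card_in_set[OF k])
  qed
  then have "pick I ` {..<card I} = I" using sub by blast
  then show ?thesis by (simp add: bij_betw_def eq_card_imp_inj_on)
qed

text \<open>The null vector \<open>y\<close> is indexed by the original row numbers, which keeps the
  renumbering by \<open>pick\<close> out of all later arguments.\<close>

lemma full_row_rank_submatrix_iff:
  fixes A :: "'a::field mat"
  assumes A: "A \<in> carrier_mat n nc" and I: "I \<subseteq> {..<n}" and J: "J \<subseteq> {..<nc}"
  shows "full_row_rank (submatrix A I J) \<longleftrightarrow>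
    (\<forall>y. (\<forall>j \<in> J. (\<Sum>k\<in>I. y k * A $$ (k, j)) = 0) \<longrightarrow> (\<forall>k \<in> I. y k = 0))"
proof -
  have fin: "finite I" "finite J" using I J finite_subset by blast+
  have c: "{i. i < dim_row A \<and> i \<in> I} = I" "{j. j < dim_col A \<and> j \<in> J} = J" using A I J by auto
  have S: "submatrix A I J \<in> carrier_mat (card I) (card J)"
    by (rule carrier_matI) (simp_all add: dim_submatrix c)
  have pI: "bij_betw (pick I) {..<card I} I" and pJ: "bij_betw (pick J) {..<card J} J"
    using bij_betw_pick fin by blast+
  have col: "vec (card I) (\<lambda>a. y (pick I a)) \<bullet> col (submatrix A I J) b = (\<Sum>k\<in>I. y k * A $$ (k, pick J b))"
    if b: "b < card J" for b and y :: "nat \<Rightarrow> 'a"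
  proof -
    have dims: "dim_row (submatrix A I J) = card I" "dim_col (submatrix A I J) = card J" using S by auto
    have "submatrix A I J $$ (a, b) = A $$ (pick I a, pick J b)" if "a < card I" for a
      using submatrix_index[of a A I b J] that b unfolding c by blast
    then have "vec (card I) (\<lambda>a. y (pick I a)) \<bullet> col (submatrix A I J) b
        = (\<Sum>a<card I. y (pick I a) * A $$ (pick I a, pick J b))"
      unfolding scalar_prod_def atLeast0LessThan dim_col dims using b dims by (intro sum.cong) simp_all
    also have "\<dots> = (\<Sum>k\<in>I. y k * A $$ (k, pick J b))"
      using sum.reindex_bij_betw[OF pI, of "\<lambda>k. y k * A $$ (k, pick J b)"] .
    finally show ?thesis .
  qed
  have surj: "\<exists>y. x = vec (card I) (\<lambda>a. y (pick I a))" if x: "x \<in> carrier_vec (card I)" for x :: "'a vec"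
  proof
    have "the_inv_into {..<card I} (pick I) (pick I a) = a" if "a < card I" for a
      using pI that by (simp add: bij_betw_def the_inv_into_f_f)
    then show "x = vec (card I) (\<lambda>a. (\<lambda>k. x $ the_inv_into {..<card I} (pick I) k) (pick I a))"
      using x by (intro eq_vecI) simp_all
  qed
  show ?thesis
    unfolding full_row_rank_iff_left_kernel[OF S]
  proof (intro iffI allI ballI impI)
    fix y k
    assume ker: "\<forall>x\<in>carrier_vec (card I). (\<forall>b<card J. x \<bullet> col (submatrix A I J) b = 0) \<longrightarrow> x = 0\<^sub>v (card I)"
      and y: "\<forall>j\<in>J. (\<Sum>k\<in>I. y k * A $$ (k, j)) = 0" and k: "k \<in> I"
    have "pick J b \<in> J" if "b < card J" for b using pJ that by (auto simp: bij_betw_def)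
    then have "\<forall>b<card J. vec (card I) (\<lambda>a. y (pick I a)) \<bullet> col (submatrix A I J) b = 0"
      using y col by simp
    then have "vec (card I) (\<lambda>a. y (pick I a)) = 0\<^sub>v (card I)"
      using ker vec_carrier by blast
    then have "y (pick I a) = 0" if "a < card I" for a using that by (metis index_vec index_zero_vec(1))
    moreover obtain a where "a < card I" "k = pick I a" using k pI by (auto simp: bij_betw_def)
    ultimately show "y k = 0" by simp
  next
    fix x :: "'a vec"
    assume ker: "\<forall>y. (\<forall>j\<in>J. (\<Sum>k\<in>I. y k * A $$ (k, j)) = 0) \<longrightarrow> (\<forall>k\<in>I. y k = 0)"
      and x: "x \<in> carrier_vec (card I)" "\<forall>b<card J. x \<bullet> col (submatrix A I J) b = 0"
    obtain y where y: "x = vec (card I) (\<lambda>a. y (pick I a))" using surj[OF x(1)] by blast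
    have "(\<Sum>k\<in>I. y k * A $$ (k, j)) = 0" if j: "j \<in> J" for j
    proof -
      obtain b where "b < card J" "j = pick J b" using pJ j by (auto simp: bij_betw_def)
      then show ?thesis using x(2) col[of b y] y by simp
    qed
    then have "\<forall>k\<in>I. y k = 0" using ker by blast
    moreover have "pick I a \<in> I" if "a < card I" for a using pI that by (auto simp: bij_betw_def)
    ultimately show "x = 0\<^sub>v (card I)" unfolding y by (intro eq_vecI) auto
  qed
qed

lemma dim_submatrix_card:
  assumes "A \<in> carrier_mat n nc" "I \<subseteq> {..<n}" "J \<subseteq> {..<nc}"
  shows "dim_row (submatrix A I J) = card I" "dim_col (submatrix A I J) = card J"
proof -
  have "{i. i < dim_row A \<and> i \<in> I} = I" "{j. j < dim_col A \<and> j \<in> J} = J" using assms by auto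
  then show "dim_row (submatrix A I J) = card I" "dim_col (submatrix A I J) = card J"
    by (simp_all add: dim_submatrix)
qed

section \<open>Fixed entries and the network equation row by row\<close>

lemma param_cols_fixed:
  assumes "\<theta> \<in> \<Theta>" "\<theta>' \<in> \<Theta>" "j < dim_col (A \<theta>)" "j \<notin> param_cols \<Theta> A i"
  shows "A \<theta> $$ (i, j) = A \<theta>' $$ (i, j)"
  using assms unfolding param_cols_def by blast

lemma param_cols_subset:
  assumes "\<And>\<theta>. \<theta> \<in> \<Theta> \<Longrightarrow> dim_col (A \<theta>) = n"
  shows "param_cols \<Theta> A i \<subseteq> {..<n}"
  using assms by (auto simp: param_cols_def)

text \<open>Subtracting the two equations gives (G1 - G0) T = U0 - U1, whose row \<open>i\<close>
  vanishes in the fixed columns \<open>J\<close>. The field is left general because the argument is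
  used over the rational functions and, at infinity, over the reals.\<close>

lemma rows_equal_of_full_row_rank:
  fixes G0 G1 T U0 U1 :: "'a::field mat"
  assumes carr: "G0 \<in> carrier_mat n n" "G1 \<in> carrier_mat n n" "T \<in> carrier_mat n k"
    and U0: "(1\<^sub>m n - G0) * T = U0" and U1: "(1\<^sub>m n - G1) * T = U1"
    and I: "I \<subseteq> {..<n}" and J: "J \<subseteq> {..<k}" and i: "i < n"
    and G: "\<And>j. j < n \<Longrightarrow> j \<notin> I \<Longrightarrow> G1 $$ (i, j) = G0 $$ (i, j)"
    and U: "\<And>j. j \<in> J \<Longrightarrow> U1 $$ (i, j) = U0 $$ (i, j)"
    and rank: "full_row_rank (submatrix T I J)"
  shows "\<forall>j < n. G1 $$ (i, j) = G0 $$ (i, j)"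
proof -
  have row: "(\<Sum>l<n. G $$ (i, l) * T $$ (l, j)) = T $$ (i, j) - U $$ (i, j)"
    if "G \<in> carrier_mat n n" "(1\<^sub>m n - G) * T = U" "j < k" for G U j
    using one_minus_mult_index[OF that(1) carr(3) i that(3)] by (simp add: that(2))
  have "(\<Sum>l\<in>I. (G1 $$ (i, l) - G0 $$ (i, l)) * T $$ (l, j)) = 0" if j: "j \<in> J" for j
  proof -
    have "(\<Sum>l\<in>I. (G1 $$ (i, l) - G0 $$ (i, l)) * T $$ (l, j))
        = (\<Sum>l<n. (G1 $$ (i, l) - G0 $$ (i, l)) * T $$ (l, j))"
      using I G by (intro sum.mono_neutral_left) auto
    also have "\<dots> = U0 $$ (i, j) - U1 $$ (i, j)"
    proof -
      have "j < k" using j J by auto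
      then show ?thesis
        unfolding left_diff_distrib sum_subtractf row[OF carr(1) U0 \<open>j < k\<close>] row[OF carr(2) U1 \<open>j < k\<close>]
        by simp
    qed
    finally show ?thesis using U[OF j] by simp
  qed
  then have "\<forall>l \<in> I. G1 $$ (i, l) - G0 $$ (i, l) = 0"
    using spec[OF iffD1[OF full_row_rank_submatrix_iff[OF carr(3) I J] rank],
        of "\<lambda>l. G1 $$ (i, l) - G0 $$ (i, l)"] by blast
  then show ?thesis using G by auto
qed

text \<open>The identifiability argument carried out at infinity, with the feedthrough of T_wr in
  place of T.\<close>

lemma C3_equal_G_inf:
  assumes set: "network_model_set L K p \<Theta> M" and C3: "cond_C3 L K \<Theta> M"
    and \<theta>: "\<theta>0 \<in> \<Theta>" "\<theta>1 \<in> \<Theta>" and Twr: "net_Twr (M \<theta>1) = net_Twr (M \<theta>0)"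
  shows "mat_inf (netG (M \<theta>1)) = mat_inf (netG (M \<theta>0))"
proof -
  have model: "network_model L K p (M \<theta>)" if "\<theta> \<in> \<Theta>" for \<theta>
    using set that by (simp add: network_model_set_def)
  interpret n0: net L K p "M \<theta>0" by unfold_locales (rule model[OF \<theta>(1)])
  interpret n1: net L K p "M \<theta>1" by unfold_locales (rule model[OF \<theta>(2)])
  have dimG: "dim_col (G_inf M \<theta>) = L" and dimR: "dim_col (R_inf M \<theta>) = K" if "\<theta> \<in> \<Theta>" for \<theta>
    using model[OF that] by (auto simp: network_model_def G_inf_def R_inf_def)
  have eq: "\<forall>j < L. mat_inf n1.G $$ (i, j) = mat_inf n0.G $$ (i, j)" if i: "i < L" for i
  proof (rule rows_equal_of_full_row_rank)
    show "(1\<^sub>m L - mat_inf n0.G) * mat_inf (net_Twr (M \<theta>0)) = mat_inf n0.R" by (rule n0.inf_G_Twr)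
    show "(1\<^sub>m L - mat_inf n1.G) * mat_inf (net_Twr (M \<theta>0)) = mat_inf n1.R"
      unfolding Twr[symmetric] by (rule n1.inf_G_Twr)
    show "full_row_rank (submatrix (mat_inf (net_Twr (M \<theta>0))) (param_cols \<Theta> (G_inf M) i)
        ({..<K} - param_cols \<Theta> (R_inf M) i))"
      using C3 i \<theta>(1) by (simp add: cond_C3_def T_check_inf_def)
    show "param_cols \<Theta> (G_inf M) i \<subseteq> {..<L}" using dimG by (rule param_cols_subset)
    show "mat_inf n1.G $$ (i, j) = mat_inf n0.G $$ (i, j)"
      if "j < L" "j \<notin> param_cols \<Theta> (G_inf M) i" for j
      using param_cols_fixed[OF \<theta>(2,1) _ that(2)] that(1) dimG[OF \<theta>(2)] unfolding G_inf_def by blast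
    show "mat_inf n1.R $$ (i, j) = mat_inf n0.R $$ (i, j)" if "j \<in> {..<K} - param_cols \<Theta> (R_inf M) i" for j
      using param_cols_fixed[OF \<theta>(2,1), of j "R_inf M" i] that dimR[OF \<theta>(2)] by (auto simp: R_inf_def)
  qed (use i n0.Twr_carr in auto)
  then show ?thesis by (intro eq_matI) auto
qed

section \<open>Identifiability\<close>

lemma response_determines_noise_model:
  assumes set: "network_model_set L K p \<Theta> M"
    and cond: "cond_C1 L \<Theta> M \<or> (\<exists>P. cond_C2 L \<Theta> M P) \<or> cond_C3 L K \<Theta> M"
    and \<theta>: "\<theta>0 \<in> \<Theta>" "\<theta>1 \<in> \<Theta>"
    and Twr: "net_Twr (M \<theta>1) = net_Twr (M \<theta>0)" and Phi: "net_Phi (M \<theta>1) = net_Phi (M \<theta>0)"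
  shows "net_Twe (M \<theta>1) = net_Twe (M \<theta>0)" "netLambda (M \<theta>1) = netLambda (M \<theta>0)"
proof -
  have m0: "network_model L K p (M \<theta>0)" and m1: "network_model L K p (M \<theta>1)"
    using set \<theta> by (simp_all add: network_model_set_def)
  have "F = netLambda (M \<theta>1)"
    if F: "F \<in> carrier_mat p p" "mat_inf (net_Twe (M \<theta>1)) * netLambda (M \<theta>1) = mat_inf (net_Twe (M \<theta>0)) * F"
      and X: "X \<in> carrier_mat p p"
        "X * map_mat complex_of_real (netLambda (M \<theta>1)) = map_mat complex_of_real F"
        "map_mat complex_of_real F * mat_adjoint X = map_mat complex_of_real (netLambda (M \<theta>0))"
    for F X
    using cond
  proof (elim disjE exE)
    assume "cond_C1 L \<Theta> M"
    then have "mat_inf (netG (M \<theta>1)) = mat_inf (netG (M \<theta>0))"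
      using \<theta> by (simp add: cond_C1_def req_C1_def)
    then show ?thesis using F by (rule feedthrough_equal_G_inf[OF m0 m1])
  next
    fix P assume "cond_C2 L \<Theta> M P"
    then have "permutation_matrix L P" "req_C2 P (M \<theta>0)" "req_C2 P (M \<theta>1)"
      using \<theta> by (auto simp: cond_C2_def)
    then show ?thesis using F X by (rule feedthrough_no_algebraic_loops[OF m0 m1])
  next
    assume "cond_C3 L K \<Theta> M"
    then have "mat_inf (netG (M \<theta>1)) = mat_inf (netG (M \<theta>0))"
      using C3_equal_G_inf[OF set _ \<theta> Twr] by blast
    then show ?thesis using F by (rule feedthrough_equal_G_inf[OF m0 m1])
  qed
  then show "net_Twe (M \<theta>1) = net_Twe (M \<theta>0)" "netLambda (M \<theta>1) = netLambda (M \<theta>0)"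
    using noise_factor_unique[OF m0 m1 Phi] by blast+
qed

lemma param_cols_netG_subset:
  assumes "network_model_set L K p \<Theta> M"
  shows "param_cols \<Theta> (\<lambda>\<theta>. netG (M \<theta>)) i \<subseteq> {..<L}"
  using assms by (intro param_cols_subset) (auto simp: network_model_set_def network_model_def)

lemma response_determines_model:
  assumes set: "network_model_set L K p \<Theta> M" and \<theta>: "\<theta>0 \<in> \<Theta>" "\<theta>1 \<in> \<Theta>"
    and Twr: "net_Twr (M \<theta>1) = net_Twr (M \<theta>0)" and Twe: "net_Twe (M \<theta>1) = net_Twe (M \<theta>0)"
    and Lam: "netLambda (M \<theta>1) = netLambda (M \<theta>0)"
    and rank: "\<And>i. i < L \<Longrightarrow> full_row_rank (T_check K p \<Theta> M \<theta>0 i)"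
  shows "M \<theta>1 = M \<theta>0"
proof -
  have model: "network_model L K p (M \<theta>)" if "\<theta> \<in> \<Theta>" for \<theta>
    using set that by (simp add: network_model_set_def)
  interpret n0: net L K p "M \<theta>0" by unfold_locales (rule model[OF \<theta>(1)])
  interpret n1: net L K p "M \<theta>1" by unfold_locales (rule model[OF \<theta>(2)])
  have T: "net_T (M \<theta>1) = net_T (M \<theta>0)" by (simp add: n0.T_eq n1.T_eq Twr Twe)
  have "\<forall>j < L. n1.G $$ (i, j) = n0.G $$ (i, j)" if i: "i < L" for i
  proof (rule rows_equal_of_full_row_rank)
    show "(1\<^sub>m L - n0.G) * net_T (M \<theta>0) = netU (M \<theta>0)" by (rule n0.GT)
    show "(1\<^sub>m L - n1.G) * net_T (M \<theta>0) = netU (M \<theta>1)" unfolding T[symmetric] by (rule n1.GT)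
    show "full_row_rank (submatrix (net_T (M \<theta>0)) (param_cols \<Theta> (\<lambda>\<theta>. netG (M \<theta>)) i)
        ({..<K + p} - param_cols \<Theta> (\<lambda>\<theta>. netU (M \<theta>)) i))"
      using rank[OF i] by (simp add: T_check_def)
    show "param_cols \<Theta> (\<lambda>\<theta>. netG (M \<theta>)) i \<subseteq> {..<L}" by (rule param_cols_netG_subset[OF set])
    show "n1.G $$ (i, j) = n0.G $$ (i, j)" if "j < L" "j \<notin> param_cols \<Theta> (\<lambda>\<theta>. netG (M \<theta>)) i" for j
      using param_cols_fixed[OF \<theta>(2,1), of j "\<lambda>\<theta>. netG (M \<theta>)"] that by simp
    show "netU (M \<theta>1) $$ (i, j) = netU (M \<theta>0) $$ (i, j)"
      if "j \<in> {..<K + p} - param_cols \<Theta> (\<lambda>\<theta>. netU (M \<theta>)) i" for j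
      using param_cols_fixed[OF \<theta>(2,1), of j "\<lambda>\<theta>. netU (M \<theta>)"] that n1.U_carr by auto
  qed (use i n0.T_carr in auto)
  then have G: "n1.G = n0.G" by (intro eq_matI) auto
  \<comment> \<open>Once \<open>G\<close> is known, the network equation (I - G) T = U returns
    \<open>U\<close>.\<close>
  have "netU (M \<theta>1) = netU (M \<theta>0)" using n0.GT n1.GT G T by simp
  then have "n1.R = n0.R" "n1.H = n0.H"
    unfolding netU_def using append_cols_eqD[OF _ n1.carr(2) n0.carr(2) n1.carr(3) n0.carr(3)] by blast+
  then show ?thesis using G Lam by simp
qed

text \<open>Comparing rows with columns of \<open>T_check\<close> gives
  \<open>card ?I \<le> K + p - card ?J\<close>. The parametrized columns of [G U] are those of G
  and, shifted by L, those of U.\<close>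

lemma card_param_cols_le:
  assumes set: "network_model_set L K p \<Theta> M" and \<theta>: "\<theta>0 \<in> \<Theta>"
    and rank: "full_row_rank (T_check K p \<Theta> M \<theta>0 i)" and i: "i < L"
  shows "card (param_cols \<Theta> (\<lambda>\<theta>. netGU (M \<theta>)) i) \<le> K + p"
proof -
  let ?I = "param_cols \<Theta> (\<lambda>\<theta>. netG (M \<theta>)) i" and ?J = "param_cols \<Theta> (\<lambda>\<theta>. netU (M \<theta>)) i"
  have model: "net L K p (M \<theta>)" if "\<theta> \<in> \<Theta>" for \<theta>
    using set that by (simp add: network_model_set_def net_def)
  have I: "?I \<subseteq> {..<L}" by (rule param_cols_netG_subset[OF set])
  have J: "?J \<subseteq> {..<K + p}" using net.U_carr[OF model] by (intro param_cols_subset) auto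
  have fin: "finite ?I" "finite ?J" using I J finite_subset by blast+
  have "card ?I \<le> card ({..<K + p} - ?J)"
    using full_row_rank_dim_le[OF rank] dim_submatrix_card[OF net.T_carr[OF model[OF \<theta>]] I, of "{..<K + p} - ?J"]
    by (simp add: T_check_def)
  also have "\<dots> = K + p - card ?J" using card_Diff_subset[OF fin(2) J] by simp
  finally have le: "card ?I + card ?J \<le> K + p" using card_mono[OF _ J] by simp
  have "param_cols \<Theta> (\<lambda>\<theta>. netGU (M \<theta>)) i \<subseteq> ?I \<union> (\<lambda>j. L + j) ` ?J"
  proof
    fix j assume "j \<in> param_cols \<Theta> (\<lambda>\<theta>. netGU (M \<theta>)) i"
    then obtain \<theta> \<theta>' where t: "\<theta> \<in> \<Theta>" "\<theta>' \<in> \<Theta>" "j < dim_col (netGU (M \<theta>))"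
      "netGU (M \<theta>) $$ (i, j) \<noteq> netGU (M \<theta>') $$ (i, j)"
      unfolding param_cols_def by blast
    have GU: "dim_col (netGU (M \<theta>)) = L + (K + p)"
      "netGU (M \<theta>) $$ (i, j) = (if j < L then netG (M \<theta>) $$ (i, j) else netU (M \<theta>) $$ (i, j - L))"
      if "\<theta> \<in> \<Theta>" "j < L + (K + p)" for \<theta>
      using net.U_carr[OF model[OF that(1)]] net.dims[OF model[OF that(1)]] i that(2)
      by (auto simp: netGU_def append_cols_index)
    have j: "j < L + (K + p)"
      using t net.U_carr[OF model[OF t(1)]] net.dims(2)[OF model[OF t(1)]] by (auto simp: netGU_def append_cols_index)
    show "j \<in> ?I \<union> (\<lambda>j. L + j) ` ?J"
    proof (cases "j < L")
      case True
      then have "j \<in> ?I"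
        using t GU(2)[OF t(1) j] GU(2)[OF t(2) j] net.dims(2)[OF model[OF t(1)]]
        unfolding param_cols_def by fastforce
      then show ?thesis by blast
    next
      case False
      have "dim_col (netU (M \<theta>)) = K + p" using net.U_carr[OF model[OF t(1)]] by simp
      then have "j - L < dim_col (netU (M \<theta>))" using False j by simp
      then have "j - L \<in> ?J"
        using t(1,2,4) GU(2)[OF t(1) j] GU(2)[OF t(2) j] False
        unfolding param_cols_def by fastforce
      then show ?thesis using False by (intro UnI2 image_eqI[of _ _ "j - L"]) auto
    qed
  qed
  then have "card (param_cols \<Theta> (\<lambda>\<theta>. netGU (M \<theta>)) i) \<le> card (?I \<union> (\<lambda>j. L + j) ` ?J)"
    using fin by (intro card_mono) auto
  also have "\<dots> \<le> card ?I + card ((\<lambda>j. L + j) ` ?J)" by (rule card_Un_le)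
  also have "\<dots> = card ?I + card ?J" by (simp add: card_image)
  finally show ?thesis using le by simp
qed

section \<open>Perturbation along a left null vector\<close>

lemma common_denominator:
  fixes y :: "nat \<Rightarrow> ratfun"
  obtains d q where "d \<noteq> 0" "\<And>k. k < n \<Longrightarrow> y k * Fract d 1 = Fract (q k) 1"
proof -
  define d where "d = (\<Prod>k<n. rf_den (y k))"
  have "\<exists>q. y k * Fract d 1 = Fract q 1" if k: "k < n" for k
  proof -
    have "rf_den (y k) dvd d" using k by (auto simp: d_def intro: dvd_prodI)
    then obtain e where e: "d = rf_den (y k) * e" by (auto simp: dvd_def)
    have "y k * Fract d 1 = Fract (rf_num (y k)) (rf_den (y k)) * Fract d 1"
      by (simp only: Fract_rf_num_den)
    also have "\<dots> = Fract (rf_num (y k) * e) 1"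
      using rf_den_neq_0[of "y k"] by (simp add: e eq_fract)
    finally show ?thesis by blast
  qed
  then have "\<forall>k. \<exists>q. k < n \<longrightarrow> y k * Fract d 1 = Fract q 1" by blast
  then obtain q where "\<forall>k. k < n \<longrightarrow> y k * Fract d 1 = Fract (q k) 1" unfolding choice_iff by blast
  moreover have "d \<noteq> 0" by (simp add: d_def rf_den_neq_0)
  ultimately show thesis by (intro that[of d q]) simp_all
qed

text \<open>The summands will be polynomials times stable functions and may be improper, so closure
  of the stable functions under sums does not apply; the denominators alone are tracked.\<close>

lemma sum_schur_denominator:
  assumes "finite I" "\<And>k. k \<in> I \<Longrightarrow> \<exists>a b. f k = Fract a b \<and> schur_poly b"
  shows "\<exists>a b. (\<Sum>k\<in>I. f k) = Fract a b \<and> schur_poly b"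
  using assms
proof (induction I)
  case empty
  then show ?case using schur_poly_1 by (auto simp: Zero_fract_def)
next
  case (insert k I)
  then obtain a b a' b' where f: "f k = Fract a b" "schur_poly b" "(\<Sum>k\<in>I. f k) = Fract a' b'" "schur_poly b'"
    by (metis insertCI)
  have "(\<Sum>k\<in>insert k I. f k) = f k + (\<Sum>k\<in>I. f k)" by (rule sum.insert[OF insert.hyps])
  also have "\<dots> = Fract (a * b' + a' * b) (b * b')" using f by (simp add: schur_poly_def)
  finally show ?case using schur_poly_mult[OF f(2,4)] by blast
qed

lemma poly_norm_le_power:
  fixes a :: "complex poly"
  assumes "cmod z \<ge> 1" "degree a \<le> m"
  shows "cmod (poly a z) \<le> (\<Sum>k\<le>degree a. cmod (coeff a k)) * cmod z ^ m"
proof -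
  have "cmod (poly a z) \<le> (\<Sum>k\<le>degree a. cmod (coeff a k * z ^ k))"
    unfolding poly_altdef by (rule norm_sum)
  also have "\<dots> \<le> (\<Sum>k\<le>degree a. cmod (coeff a k) * cmod z ^ m)"
    using assms by (intro sum_mono) (auto simp: norm_mult norm_power intro!: mult_left_mono power_increasing)
  finally show ?thesis by (simp add: sum_distrib_right)
qed

text \<open>For |z| \<ge> 1 the value |a(z)| is at most A |z|^m, with A the sum of the absolute
  values of the coefficients. With \<open>\<epsilon> = 1 / (A + 1)\<close> the subtracted term stays
  strictly below |z|^m, so no zero lies there. The same \<open>\<epsilon>\<close> serves every m,
  which leaves m free to be taken large.\<close>

lemma monom_minus_small_schur:
  obtains \<epsilon> where "\<epsilon> \<noteq> 0" "\<And>m. degree a < m \<Longrightarrow> schur_poly (monom 1 m - smult \<epsilon> a)"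
proof -
  define A where "A = (\<Sum>k\<le>degree (cpoly a). cmod (coeff (cpoly a) k))"
  have A: "A \<ge> 0" unfolding A_def by (intro sum_nonneg) auto
  define \<epsilon> where "\<epsilon> = 1 / (A + 1)"
  have e: "\<epsilon> > 0" "\<epsilon> * A < 1" using A by (simp_all add: \<epsilon>_def field_simps)
  have "schur_poly (monom 1 m - smult \<epsilon> a)" if m: "degree a < m" for m
    unfolding schur_poly_def
  proof (intro conjI allI impI)
    have "coeff (monom 1 m - smult \<epsilon> a) m = 1" using m by (simp add: coeff_eq_0)
    then show "monom 1 m - smult \<epsilon> a \<noteq> 0" by (metis coeff_0 zero_neq_one)
    fix z assume "poly (cpoly (monom 1 m - smult \<epsilon> a)) z = 0"
    moreover have "cpoly (monom 1 m - smult \<epsilon> a) = monom 1 m - smult (of_real \<epsilon>) (cpoly a)"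
      by (auto simp: poly_eq_iff coeff_map_poly)
    ultimately have z: "z ^ m = of_real \<epsilon> * poly (cpoly a) z" by (simp add: poly_monom)
    show "cmod z < 1"
    proof (rule ccontr)
      assume "\<not> cmod z < 1"
      then have z1: "cmod z \<ge> 1" by simp
      have "cmod z ^ m = \<epsilon> * cmod (poly (cpoly a) z)"
        using arg_cong[OF z, of cmod] e by (simp add: norm_mult norm_power)
      also have "\<dots> \<le> \<epsilon> * (A * cmod z ^ m)"
        using e m poly_norm_le_power[OF z1, of "cpoly a" m]
        by (intro mult_left_mono) (auto simp: degree_cpoly A_def)
      also have "\<dots> = \<epsilon> * A * cmod z ^ m" by simp
      finally have "1 * cmod z ^ m \<le> \<epsilon> * A * cmod z ^ m" by simp
      moreover have "cmod z ^ m > 0" using z1 by (intro zero_less_power) linarith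
      ultimately have "1 \<le> \<epsilon> * A" by (simp only: mult_le_cancel_right_pos)
      then show False using e by simp
    qed
  qed
  moreover have "\<epsilon> \<noteq> 0" using e by simp
  ultimately show thesis by (rule that[rotated])
qed

text \<open>The multiplier \<open>\<epsilon> d b / z\<^sup>m\<close>, with \<open>d\<close> a common denominator of \<open>y\<close> and \<open>\<Sum>k. d y\<^sub>k w\<^sub>k = a / b\<close>,
  turns the sum into \<open>\<epsilon> a / z\<^sup>m\<close>, which is small outside the open unit disc.\<close>

lemma small_stable_multiple:
  fixes y w :: "nat \<Rightarrow> ratfun"
  assumes w: "\<And>k. k < n \<Longrightarrow> rf_stable (w k)"
  obtains c where "c \<noteq> 0" "\<And>k. k < n \<Longrightarrow> rf_stable (c * y k)" "\<And>k. k < n \<Longrightarrow> rf_inf (c * y k) = 0"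
    "1 - (\<Sum>k<n. c * y k * w k) \<noteq> 0" "rf_stable (inverse (1 - (\<Sum>k<n. c * y k * w k)))"
proof -
  obtain d q where d: "d \<noteq> 0" and q: "\<And>k. k < n \<Longrightarrow> y k * Fract d 1 = Fract (q k) 1"
    using common_denominator[of n y] by blast
  have "\<exists>a b. Fract (q k) 1 * w k = Fract a b \<and> schur_poly b" if "k < n" for k
  proof -
    obtain a b where "w k = Fract a b" "schur_poly b" using w[OF \<open>k < n\<close>] by (rule rf_stableE)
    moreover from this have "Fract (q k) 1 * w k = Fract (q k * a) b" by simp
    ultimately show ?thesis by blast
  qed
  then obtain a b where s: "(\<Sum>k<n. Fract (q k) 1 * w k) = Fract a b" and b: "schur_poly b"
    using sum_schur_denominator[of "{..<n}" "\<lambda>k. Fract (q k) 1 * w k"] by auto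
  obtain \<epsilon> where e: "\<epsilon> \<noteq> 0" and schur: "\<And>m. degree a < m \<Longrightarrow> schur_poly (monom 1 m - smult \<epsilon> a)"
    using monom_minus_small_schur[of a] by blast
  \<comment> \<open>Large enough to make every \<open>c * y k\<close> strictly proper and to let z^m
    dominate \<open>a\<close>.\<close>
  define m where "m = Suc (degree a + degree b + (\<Sum>k<n. degree (q k)))"
  have m: "degree a < m" "k < n \<Longrightarrow> degree b + degree (q k) < m" for k
    using member_le_sum[of k "{..<n}" "\<lambda>k. degree (q k)"] by (auto simp: m_def)
  define c where "c = Fract (smult \<epsilon> b) (monom 1 m) * Fract d 1"
  have b0: "b \<noteq> 0" using b by (simp add: schur_poly_def)
  have z: "monom (1::real) m \<noteq> 0" by (simp add: monom_eq_0_iff)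
  have cy: "c * y k = Fract (smult \<epsilon> b * q k) (monom 1 m)" if "k < n" for k
  proof -
    have "c * y k = Fract (smult \<epsilon> b) (monom 1 m) * (y k * Fract d 1)" by (simp add: c_def mult_ac)
    then show ?thesis by (simp add: q[OF that])
  qed
  have deg: "degree (smult \<epsilon> b * q k) < m" if "k < n" for k
    using m(2)[OF that] degree_mult_le[of "smult \<epsilon> b" "q k"] by (simp add: e)
  have "(\<Sum>k<n. c * y k * w k) = Fract (smult \<epsilon> b) (monom 1 m) * (\<Sum>k<n. Fract (q k) 1 * w k)"
    unfolding sum_distrib_left mult.assoc[symmetric] by (intro sum.cong) (simp_all add: cy)
  also have "\<dots> = Fract (smult \<epsilon> a) (monom 1 m)"
    unfolding s using b0 z by (simp add: eq_fract mult_ac)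
  finally have "1 - (\<Sum>k<n. c * y k * w k) = Fract (monom 1 m - smult \<epsilon> a) (monom 1 m)"
    using z by (simp add: One_fract_def)
  moreover have sp: "schur_poly (monom 1 m - smult \<epsilon> a)" by (rule schur[OF m(1)])
  moreover from sp have "monom 1 m - smult \<epsilon> a \<noteq> 0" by (simp add: schur_poly_def)
  \<comment> \<open>The coefficient 1 at z^m survives, so the inverse, which has numerator z^m, is
    proper.\<close>
  moreover have "degree (monom 1 m - smult \<epsilon> a) \<ge> m"
    using m(1) by (intro le_degree) (simp add: coeff_eq_0)
  then have "rf_stable (Fract (monom 1 m) (monom 1 m - smult \<epsilon> a))"
    using sp by (intro rf_stableI) (auto simp: degree_monom_eq)
  ultimately have "1 - (\<Sum>k<n. c * y k * w k) \<noteq> 0" "rf_stable (inverse (1 - (\<Sum>k<n. c * y k * w k)))"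
    using z by (auto simp: Zero_fract_def eq_fract)
  moreover have "c \<noteq> 0" using d e b0 z by (simp add: c_def Zero_fract_def eq_fract)
  moreover have "rf_stable (c * y k)" "rf_inf (c * y k) = 0" if "k < n" for k
    using deg[OF that] z schur_poly_monom[of m] unfolding cy[OF that]
    by (auto simp: degree_monom_eq rf_inf_Fract coeff_eq_0 simp del: mult_smult_left intro!: rf_stableI)
  ultimately show thesis by (intro that[of c]) simp_all
qed

lemma submatrix_map_mat: "submatrix (map_mat f A) I J = map_mat f (submatrix A I J)"
  by (intro eq_matI) (auto simp: submatrix_def intro!: index_map_mat pick_le)

context net begin

text \<open>With \<open>E = e\<^sub>i x\<^sup>T\<close> one has \<open>E W E = s E\<close> for \<open>s = (x\<^sup>T W)\<^sub>i\<close>, which gives the inverse of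
  \<open>I - G - E\<close> in the style of Sherman and Morrison.\<close>

lemma perturbed_inverse:
  assumes i: "i < L" and E: "E = mat L L (\<lambda>(a, b). if a = i then x b else 0)"
    and s: "s = (\<Sum>k<L. x k * W $$ (k, i))" "1 - s \<noteq> 0"
  shows "(1\<^sub>m L - (G + E)) * (W + inverse (1 - s) \<cdot>\<^sub>m (W * E * W)) = 1\<^sub>m L"
proof -
  have Ec: "E \<in> carrier_mat L L" "dim_row E = L" "dim_col E = L" by (simp_all add: E)
  have EW: "(E * W) $$ (a, b) = (if a = i then \<Sum>k<L. x k * W $$ (k, b) else 0)" if "a < L" "b < L" for a b
    using that by (simp add: index_mult_mat_sum E del: index_mult_mat(1))
  have EWE: "E * W * E = s \<cdot>\<^sub>m E"
  proof (rule eq_matI)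
    fix a b assume "a < dim_row (s \<cdot>\<^sub>m E)" "b < dim_col (s \<cdot>\<^sub>m E)"
    then have ab: "a < L" "b < L" by (simp_all add: Ec)
    have "(E * W * E) $$ (a, b) = (\<Sum>k<L. (E * W) $$ (a, k) * E $$ (k, b))"
      using ab Ec by (intro index_mult_mat_sum) auto
    also have "\<dots> = (\<Sum>k<L. if k = i then (E * W) $$ (a, k) * x b else 0)"
      using ab by (intro sum.cong) (simp_all add: E del: index_mult_mat(1))
    also have "\<dots> = (if a = i then s * x b else 0)" using i ab by (simp add: EW s(1) del: index_mult_mat(1))
    finally show "(E * W * E) $$ (a, b) = (s \<cdot>\<^sub>m E) $$ (a, b)" using ab by (simp add: E del: index_mult_mat(1))
  qed (simp_all add: Ec)
  define u where "u = inverse (1 - s)"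
  have u: "u * (1 - s) = 1" using s(2) by (simp add: u_def)
  define Z where "Z = E * W"
  have Z: "Z \<in> carrier_mat L L" "dim_row Z = L" "dim_col Z = L" using Ec by (auto simp: Z_def)
  have c: "1\<^sub>m L - G \<in> carrier_mat L L" "W * E * W \<in> carrier_mat L L" "u \<cdot>\<^sub>m (W * E * W) \<in> carrier_mat L L"
    "W + u \<cdot>\<^sub>m (W * E * W) \<in> carrier_mat L L"
    using Ec by auto
  have split: "1\<^sub>m L - (G + E) = (1\<^sub>m L - G) - E" using Ec by (intro eq_matI) auto
  have GW: "(1\<^sub>m L - G) * (W * E * W) = Z"
  proof -
    have "(1\<^sub>m L - G) * (W * E * W) = ((1\<^sub>m L - G) * W) * (E * W)" using Ec by (simp add: mat_assoc)
    then show ?thesis using Ec by (simp add: W_right Z_def)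
  qed
  have EWEW: "E * (W * E * W) = s \<cdot>\<^sub>m Z"
  proof -
    have "E * (W * E * W) = (E * W * E) * W" using Ec by (simp add: mat_assoc)
    also have "\<dots> = s \<cdot>\<^sub>m Z" unfolding EWE Z_def by (rule mult_smult_assoc_mat[OF Ec(1) W_carr])
    finally show ?thesis .
  qed
  have "(1\<^sub>m L - (G + E)) * (W + u \<cdot>\<^sub>m (W * E * W))
    = (1\<^sub>m L - G) * (W + u \<cdot>\<^sub>m (W * E * W)) - E * (W + u \<cdot>\<^sub>m (W * E * W))"
    unfolding split by (rule minus_mult_distrib_mat[OF c(1) Ec(1) c(4)])
  also have "(1\<^sub>m L - G) * (W + u \<cdot>\<^sub>m (W * E * W)) = 1\<^sub>m L + u \<cdot>\<^sub>m Z"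
    using mult_add_distrib_mat[OF c(1) W_carr c(3)] mult_smult_distrib[OF c(1,2), of u] by (simp add: W_right GW)
  also have "E * (W + u \<cdot>\<^sub>m (W * E * W)) = Z + u \<cdot>\<^sub>m (s \<cdot>\<^sub>m Z)"
    using mult_add_distrib_mat[OF Ec(1) W_carr c(3)] mult_smult_distrib[OF Ec(1) c(2), of u] by (simp add: EWEW Z_def)
  \<comment> \<open>The terms in \<open>Z\<close> carry the factor u (1 - s) - 1, which is 0 by the
    choice of \<open>u\<close>.\<close>
  also have "1\<^sub>m L + u \<cdot>\<^sub>m Z - (Z + u \<cdot>\<^sub>m (s \<cdot>\<^sub>m Z)) = 1\<^sub>m L"
  proof (rule eq_matI)
    fix a b assume "a < dim_row (1\<^sub>m L :: ratfun mat)" "b < dim_col (1\<^sub>m L :: ratfun mat)"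
    then have "a < L" "b < L" by auto
    moreover have "t + u * v - (v + u * (s * v)) = t" for t v :: ratfun
    proof -
      have "t + u * v - (v + u * (s * v)) = t + (u * (1 - s) - 1) * v" by (simp add: algebra_simps)
      then show ?thesis by (simp add: u)
    qed
    ultimately show "(1\<^sub>m L + u \<cdot>\<^sub>m Z - (Z + u \<cdot>\<^sub>m (s \<cdot>\<^sub>m Z))) $$ (a, b) = 1\<^sub>m L $$ (a, b)"
      using Z by simp
  qed (use Z in simp_all)
  finally show ?thesis by (simp add: u_def)
qed

end

lemma row_mat_mult_index:
  fixes x :: "nat \<Rightarrow> 'a::semiring_0"
  assumes "T \<in> carrier_mat n k" "a < n" "j < k"
  shows "(mat n n (\<lambda>(a, b). if a = i then x b else 0) * T) $$ (a, j)
    = (if a = i then \<Sum>l<n. x l * T $$ (l, j) else 0)"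
  using assms by (simp add: index_mult_mat_sum del: index_mult_mat(1))

context net begin

lemma G_Twr: "(1\<^sub>m L - G) * net_Twr m = R" and G_Twe: "(1\<^sub>m L - G) * net_Twe m = H"
  by (simp_all add: net_Twr_def net_Twe_def mat_assoc[symmetric] W_right)

text \<open>Moving \<open>G\<close> by \<open>E\<close> and \<open>U\<close> by \<open>- E T\<close> leaves the response \<open>T\<close> unchanged.\<close>

lemma perturbed_model:
  assumes E: "E \<in> carrier_mat L L" "stable_mat E" "mat_inf E = 0\<^sub>m L L" "\<And>a. a < L \<Longrightarrow> E $$ (a, a) = 0"
    and V: "V \<in> carrier_mat L L" "stable_mat V" "(1\<^sub>m L - (G + E)) * V = 1\<^sub>m L"
  defines "m1 \<equiv> \<lparr>netG = G + E, netR = R - E * net_Twr m, netH = H - E * net_Twe m, netLambda = Lam\<rparr>"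
  shows "network_model L K p m1" "net_Twr m1 = net_Twr m" "net_Twe m1 = net_Twe m"
    "mat_inf (netG m1) = mat_inf G" "mat_inf (netR m1) = mat_inf R" "mat_inf (netH m1) = mat_inf H"
proof -
  have Ed: "dim_row E = L" "dim_col E = L" and Vd: "dim_row V = L" "dim_col V = L" using E V by auto
  have Td: "dim_row (net_Twr m) = L" "dim_col (net_Twr m) = K" "dim_row (net_Twe m) = L" "dim_col (net_Twe m) = p"
    using Twr_carr Twe_carr by auto
  have c1: "1\<^sub>m L - (G + E) \<in> carrier_mat L L" using Ed by auto
  have VG: "V * (1\<^sub>m L - (G + E)) = 1\<^sub>m L"
    by (rule mat_mult_left_right_inverse[OF c1 V(1) V(3)])
  have inv: "invertible_mat (1\<^sub>m L - (G + E))"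
    using V(3) VG Ed Vd unfolding invertible_mat_def inverts_mat_def by (intro conjI exI[of _ V]) auto
  have "minv (1\<^sub>m L - (G + E)) = minv (1\<^sub>m L - (G + E)) * ((1\<^sub>m L - (G + E)) * V)"
    unfolding V(3) using minv(1)[OF c1 inv] by simp
  also have "\<dots> = V"
    using minv(1,3)[OF c1 inv] Ed Vd by (simp add: mat_assoc[symmetric])
  finally have W1: "I_minus_G_inv m1 = V" using Ed by (simp add: I_minus_G_inv_def m1_def)
  have split: "1\<^sub>m L - (G + E) = (1\<^sub>m L - G) - E" using Ed by (intro eq_matI) auto
  have R1: "(1\<^sub>m L - (G + E)) * net_Twr m = R - E * net_Twr m"
    unfolding split using minus_mult_distrib_mat[of "1\<^sub>m L - G" L L E "net_Twr m" K] E Twr_carr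
    by (simp add: G_Twr minus_carrier_mat)
  have H1: "(1\<^sub>m L - (G + E)) * net_Twe m = H - E * net_Twe m"
    unfolding split using minus_mult_distrib_mat[of "1\<^sub>m L - G" L L E "net_Twe m" p] E Twe_carr
    by (simp add: G_Twe minus_carrier_mat)
  have cancel: "V * ((1\<^sub>m L - (G + E)) * T) = T" if "dim_row T = L" for T
    using that Ed Vd VG by (simp add: mat_assoc[symmetric])
  show Twr: "net_Twr m1 = net_Twr m"
    using cancel[OF Td(1)] by (simp add: net_Twr_def[of m1] W1) (simp add: m1_def R1)
  show Twe: "net_Twe m1 = net_Twe m"
    using cancel[OF Td(3)] by (simp add: net_Twe_def[of m1] W1) (simp add: m1_def H1)
  have Ep: "proper_mat E" using E(2) by (rule stable_mat_proper)
  have ET: "proper_mat (E * net_Twr m)" "stable_mat (E * net_Twe m)"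
    using E Ep Ed Td by (auto intro!: proper_mat_mult stable_mat_mult Twr_proper Twe_stable)
  \<comment> \<open>\<open>E\<close> is strictly proper and the responses are proper, so the
    corrections of \<open>R\<close> and \<open>H\<close> vanish at infinity.\<close>
  have infET: "mat_inf (E * net_Twr m) = 0\<^sub>m L K" "mat_inf (E * net_Twe m) = 0\<^sub>m L p"
    using Ep Ed Td Twr_proper stable_mat_proper[OF Twe_stable] E(3) by (simp_all add: mat_inf_mult)
  show Ginf: "mat_inf (netG m1) = mat_inf G"
    using rf_inf.hom_mat_add[of G E] proper(1) Ep Ed E(3) by (simp add: m1_def proper_mat_iff)
  show Rinf: "mat_inf (netR m1) = mat_inf R"
    using rf_inf.hom_mat_minus[of R "E * net_Twr m"] stable(4) ET Ed Td infET(1)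
    by (simp add: m1_def proper_mat_iff) (intro eq_matI; simp)
  show Hinf: "mat_inf (netH m1) = mat_inf H"
    using rf_inf.hom_mat_minus[of H "E * net_Twe m"] proper(2) stable_mat_proper[OF ET(2)] Ed Td infET(2)
    by (simp add: m1_def proper_mat_iff) (intro eq_matI; simp)
  obtain D where D: "D \<in> carrier_mat p L" "stable_mat D" "D * net_Twe m = 1\<^sub>m p" by (rule T_left_inv)
  show "network_model L K p m1"
    unfolding network_model_def
  proof (intro conjI allI impI)
    show "netG m1 \<in> carrier_mat L L" "netR m1 \<in> carrier_mat L K" "netH m1 \<in> carrier_mat L p"
      using Ed Td by (auto simp: m1_def)
    show "stable_mat (netG m1)"
      using rf_stable.mat_over_add[of G E] stable(1) E Ed by (simp add: m1_def stable_mat_iff)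
    show "proper_mat (netR m1)"
      using rf_inf.mat_over_minus[of R "E * net_Twr m"] stable(4) ET(1) Ed Td by (simp add: m1_def proper_mat_iff)
    show "stable_mat (netH m1)"
      using rf_stable.mat_over_minus[of H "E * net_Twe m"] stable(2) ET(2) Ed Td by (simp add: m1_def stable_mat_iff)
    show "netG m1 $$ (a, a) = 0" if "a < L" for a
      using that E(4) G_diag Ed by (simp add: m1_def)
    show "mat_inf (submatrix (netH m1) {..<p} UNIV) = 1\<^sub>m p"
      using model unfolding submatrix_map_mat[symmetric] Hinf
      by (simp add: submatrix_map_mat network_model_def)
    \<comment> \<open>The new noise model equals (I - G - E) T_we with the old T_we, so
      \<open>V\<close> followed by the left inverse \<open>D\<close> of T_we undoes it.\<close>
    have "D * V * netH m1 = 1\<^sub>m p"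
    proof -
      have "D * V * netH m1 = D * (V * ((1\<^sub>m L - (G + E)) * net_Twe m))"
        using D Ed Vd Td by (simp add: H1 mat_assoc m1_def)
      then show ?thesis using cancel[OF Td(3)] D(3) by simp
    qed
    then show "\<exists>Hd\<in>carrier_mat p L. stable_mat Hd \<and> Hd * netH m1 = 1\<^sub>m p"
      using D V by (intro bexI[of _ "D * V"]) (auto intro!: stable_mat_mult)
    show "well_posed L (netG m1)" using model Ginf by (simp add: well_posed_def network_model_def)
    show "invertible_mat (1\<^sub>m L - netG m1)" using inv by (simp add: m1_def)
    show "stable_mat (I_minus_G_inv m1)" using V(2) W1 by simp
    show "pos_def_mat p (netLambda m1)" using model by (simp add: m1_def network_model_def)
  qed (rule p_le_L)
qed

text \<open>The multiplier comes from \<open>small_stable_multiple\<close> with column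
  \<open>i\<close> of \<open>W\<close> as weights; this makes 1 - s, the divisor in
  \<open>perturbed_inverse\<close>, a unit among the stable functions. The condition
  \<open>y i = 0\<close> keeps the diagonal of G zero. Row \<open>i\<close> of \<open>R\<close> and
  \<open>H\<close> changes by a multiple of the combination of the rows of T with weights
  \<open>y\<close>, so it stays put in the columns where that combination vanishes.\<close>

lemma equivalent_model_along_null_vector:
  assumes i: "i < L" and y: "k0 < L" "y k0 \<noteq> 0" "y i = 0"
  obtains m1 where "network_model L K p m1" "netLambda m1 = Lam"
    "net_Twr m1 = net_Twr m" "net_Twe m1 = net_Twe m"
    "mat_inf (netG m1) = mat_inf G" "mat_inf (netR m1) = mat_inf R" "mat_inf (netH m1) = mat_inf H"
    "netG m1 \<noteq> G"
    "\<forall>a<L. \<forall>b<L. a \<noteq> i \<or> y b = 0 \<longrightarrow> netG m1 $$ (a, b) = G $$ (a, b)"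
    "\<forall>a<L. \<forall>j<K. a \<noteq> i \<or> (\<Sum>k<L. y k * net_Twr m $$ (k, j)) = 0 \<longrightarrow>
      netR m1 $$ (a, j) = R $$ (a, j)"
    "\<forall>a<L. \<forall>j<p. a \<noteq> i \<or> (\<Sum>k<L. y k * net_Twe m $$ (k, j)) = 0 \<longrightarrow>
      netH m1 $$ (a, j) = H $$ (a, j)"
proof -
  have "rf_stable (W $$ (k, i))" if "k < L" for k
    using stable(3) that i by (simp add: stable_mat_def)
  from small_stable_multiple[of L "\<lambda>k. W $$ (k, i)" y, OF this]
  obtain c where c: "c \<noteq> 0" "\<And>k. k < L \<Longrightarrow> rf_stable (c * y k)" "\<And>k. k < L \<Longrightarrow> rf_inf (c * y k) = 0"
    "1 - (\<Sum>k<L. c * y k * W $$ (k, i)) \<noteq> 0"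
    "rf_stable (inverse (1 - (\<Sum>k<L. c * y k * W $$ (k, i))))"
    by blast
  define E where "E = mat L L (\<lambda>(a, b). if a = i then c * y b else 0)"
  define s where "s = (\<Sum>k<L. c * y k * W $$ (k, i))"
  define V where "V = W + inverse (1 - s) \<cdot>\<^sub>m (W * E * W)"
  have Ed: "E \<in> carrier_mat L L" "dim_row E = L" "dim_col E = L" by (simp_all add: E_def)
  have Es: "stable_mat E"
    using c(2) rf_stable.zero_closed by (auto simp: stable_mat_def E_def)
  have Einf: "mat_inf E = 0\<^sub>m L L"
    by (intro eq_matI) (auto simp: E_def c(3) rf_inf.hom_zero)
  have Ediag: "E $$ (a, a) = 0" if "a < L" for a using that y(3) by (simp add: E_def)
  have inv: "(1\<^sub>m L - (G + E)) * V = 1\<^sub>m L"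
    unfolding V_def by (rule perturbed_inverse[OF i E_def s_def]) (use c(4) in \<open>simp add: s_def\<close>)
  have "stable_mat (W * E * W)" using stable(3) Es Ed by (auto intro!: stable_mat_mult)
  then have Vs: "stable_mat V"
    using rf_stable.mat_over_add[of W "inverse (1 - s) \<cdot>\<^sub>m (W * E * W)"]
      rf_stable.mat_over_smult[of "inverse (1 - s)" "W * E * W"] stable(3) c(5)
    by (simp add: V_def stable_mat_iff s_def)
  have Vc: "V \<in> carrier_mat L L" unfolding V_def by (intro carrier_matI) simp_all
  let ?m1 = "\<lparr>netG = G + E, netR = R - E * net_Twr m, netH = H - E * net_Twe m, netLambda = Lam\<rparr>"
  note pm = perturbed_model[OF Ed(1) Es Einf Ediag Vc Vs inv]
  have ET: "(E * T) $$ (a, j) = (if a = i then c * (\<Sum>k<L. y k * T $$ (k, j)) else 0)"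
    if "T \<in> carrier_mat L n" "a < L" "j < n" for T n a j
    unfolding E_def row_mat_mult_index[OF that] by (simp add: sum_distrib_left mult.assoc)
  show thesis
  proof (rule that[of ?m1])
    show "netG ?m1 \<noteq> G"
    proof
      assume "netG ?m1 = G"
      then have "(G + E) $$ (i, k0) = G $$ (i, k0)" by simp
      then show False using i y c(1) by (simp add: E_def)
    qed
    show "\<forall>a<L. \<forall>b<L. a \<noteq> i \<or> y b = 0 \<longrightarrow> netG ?m1 $$ (a, b) = G $$ (a, b)"
      by (auto simp: E_def)
    show "\<forall>a<L. \<forall>j<K. a \<noteq> i \<or> (\<Sum>k<L. y k * net_Twr m $$ (k, j)) = 0 \<longrightarrow>
      netR ?m1 $$ (a, j) = R $$ (a, j)"
      using ET[OF Twr_carr] Ed Twr_carr by (auto simp del: index_mult_mat(1))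
    show "\<forall>a<L. \<forall>j<p. a \<noteq> i \<or> (\<Sum>k<L. y k * net_Twe m $$ (k, j)) = 0 \<longrightarrow>
      netH ?m1 $$ (a, j) = H $$ (a, j)"
      using ET[OF Twe_carr] Ed Twe_carr by (auto simp del: index_mult_mat(1))
  qed (use pm in simp_all)
qed

end

text \<open>Captures what the perturbation preserves: the covariance, T_wr and every feedthrough. It
  lets one argument treat the three conditions together.\<close>

definition requirement_depends_on_response :: "nat \<Rightarrow> nat \<Rightarrow> nat \<Rightarrow> (net_model \<Rightarrow> bool) \<Rightarrow> bool" where
  "requirement_depends_on_response L K p req \<longleftrightarrow> (\<forall>m m'. network_model L K p m \<longrightarrow> network_model L K p m' \<longrightarrow>
    netLambda m' = netLambda m \<longrightarrow> net_Twr m' = net_Twr m \<longrightarrow>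
    mat_inf (netG m') = mat_inf (netG m) \<longrightarrow> mat_inf (netR m') = mat_inf (netR m) \<longrightarrow>
    mat_inf (netH m') = mat_inf (netH m) \<longrightarrow> req m \<longrightarrow> req m')"

lemma requirements_depend_on_response:
  "requirement_depends_on_response L K p (req_C1 L)"
  "requirement_depends_on_response L K p (req_C2 P)"
  "requirement_depends_on_response L K p (req_C3 L K \<Theta> M)"
  by (simp_all add: requirement_depends_on_response_def req_C1_def req_C2_def req_C3_def T_check_inf_def)

lemma full_row_rank_of_identifiable:
  assumes set: "network_model_set L K p \<Theta> M" and \<theta>: "\<theta>0 \<in> \<Theta>" and i: "i < L"
    and free: "freely_parametrized L K p \<Theta> M req"
    and req: "requirement_depends_on_response L K p req" "req (M \<theta>0)"
    and id: "globally_identifiable_at \<Theta> M \<theta>0"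
  shows "full_row_rank (T_check K p \<Theta> M \<theta>0 i)"
proof (rule ccontr)
  assume contra: "\<not> full_row_rank (T_check K p \<Theta> M \<theta>0 i)"
  have models: "network_model L K p (M \<theta>)" if "\<theta> \<in> \<Theta>" for \<theta>
    using set that by (simp add: network_model_set_def)
  interpret net L K p "M \<theta>0" by unfold_locales (rule models[OF \<theta>])
  let ?I = "param_cols \<Theta> (\<lambda>\<theta>. netG (M \<theta>)) i" and ?J = "{..<K + p} - param_cols \<Theta> (\<lambda>\<theta>. netU (M \<theta>)) i"
  have I: "?I \<subseteq> {..<L}" by (rule param_cols_netG_subset[OF set])
  obtain z k0 where z: "\<And>j. j \<in> ?J \<Longrightarrow> (\<Sum>k\<in>?I. z k * net_T (M \<theta>0) $$ (k, j)) = 0" "k0 \<in> ?I" "z k0 \<noteq> 0"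
    using contra full_row_rank_submatrix_iff[OF T_carr I, of ?J] unfolding T_check_def by blast
  \<comment> \<open>Extension by zero, so that the perturbation touches only parametrized entries of
    row \<open>i\<close> of G.\<close>
  define y where "y k = (if k \<in> ?I then z k else 0)" for k
  have yT: "(\<Sum>k<L. y k * net_T (M \<theta>0) $$ (k, j)) = 0" if "j \<in> ?J" for j
  proof -
    have "(\<Sum>k<L. y k * net_T (M \<theta>0) $$ (k, j)) = (\<Sum>k\<in>?I. z k * net_T (M \<theta>0) $$ (k, j))"
      using I by (intro sum.mono_neutral_cong_right) (auto simp: y_def)
    then show ?thesis using z(1)[OF that] by simp
  qed
  have "netG (M \<theta>) $$ (i, i) = 0" if "\<theta> \<in> \<Theta>" for \<theta>
    using models[OF that] i by (simp add: network_model_def)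
  \<comment> \<open>The diagonal of G is fixed to 0, whence \<open>y i = 0\<close> as the
    perturbation demands.\<close>
  then have "i \<notin> ?I" unfolding param_cols_def by auto
  then have yi: "y i = 0" by (simp add: y_def)
  have k0: "k0 < L" "y k0 \<noteq> 0" using z I by (auto simp: y_def)
  have T: "net_T (M \<theta>0) $$ (k, j) = (if j < K then net_Twr (M \<theta>0) $$ (k, j) else net_Twe (M \<theta>0) $$ (k, j - K))"
    if "k < L" "j < K + p" for k j
    unfolding T_eq using that Twr_carr Twe_carr by (auto simp: append_cols_index)
  have U: "netU (M \<theta>) $$ (a, j) = (if j < K then netR (M \<theta>) $$ (a, j) else netH (M \<theta>) $$ (a, j - K))"
    if "\<theta> \<in> \<Theta>" "a < L" "j < K + p" for \<theta> a j
    using models[OF that(1)] that(2,3) by (auto simp: netU_def append_cols_index network_model_def)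
  obtain m1 where m1: "network_model L K p m1" "netLambda m1 = Lam"
    "net_Twr m1 = net_Twr (M \<theta>0)" "net_Twe m1 = net_Twe (M \<theta>0)"
    "mat_inf (netG m1) = mat_inf G" "mat_inf (netR m1) = mat_inf R" "mat_inf (netH m1) = mat_inf H"
    "netG m1 \<noteq> G"
    and eG: "\<forall>a<L. \<forall>b<L. a \<noteq> i \<or> y b = 0 \<longrightarrow> netG m1 $$ (a, b) = G $$ (a, b)"
    and eR: "\<forall>a<L. \<forall>j<K. a \<noteq> i \<or> (\<Sum>k<L. y k * net_Twr (M \<theta>0) $$ (k, j)) = 0 \<longrightarrow>
      netR m1 $$ (a, j) = R $$ (a, j)"
    and eH: "\<forall>a<L. \<forall>j<p. a \<noteq> i \<or> (\<Sum>k<L. y k * net_Twe (M \<theta>0) $$ (k, j)) = 0 \<longrightarrow>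
      netH m1 $$ (a, j) = H $$ (a, j)"
    by (rule equivalent_model_along_null_vector[OF i k0 yi])
  have sG: "same_fixed_entries \<Theta> (\<lambda>\<theta>. netG (M \<theta>)) (netG m1)"
    unfolding same_fixed_entries_def
  proof (intro ballI allI impI)
    fix \<theta> a b assume t: "\<theta> \<in> \<Theta>" "a < dim_row (netG (M \<theta>))" "b < dim_col (netG (M \<theta>))"
      "b \<notin> param_cols \<Theta> (\<lambda>\<theta>. netG (M \<theta>)) a"
    then have "a < L" "b < L" using models[OF t(1)] by (auto simp: network_model_def)
    moreover have "a \<noteq> i \<or> y b = 0" using t(4) by (auto simp: y_def)
    ultimately have "netG m1 $$ (a, b) = G $$ (a, b)" using eG by blast
    also have "\<dots> = netG (M \<theta>) $$ (a, b)"
      using param_cols_fixed[OF t(1) \<theta>, of b "\<lambda>\<theta>. netG (M \<theta>)" a] t(3,4) by simp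
    finally show "netG m1 $$ (a, b) = netG (M \<theta>) $$ (a, b)" .
  qed
  have sR: "same_fixed_entries \<Theta> (\<lambda>\<theta>. netR (M \<theta>)) (netR m1)"
    unfolding same_fixed_entries_def
  proof (intro ballI allI impI)
    fix \<theta> a j assume t: "\<theta> \<in> \<Theta>" "a < dim_row (netR (M \<theta>))" "j < dim_col (netR (M \<theta>))"
      "j \<notin> param_cols \<Theta> (\<lambda>\<theta>. netR (M \<theta>)) a"
    then have aj: "a < L" "j < K" using models[OF t(1)] by (auto simp: network_model_def)
    \<comment> \<open>In row \<open>i\<close> a fixed entry of \<open>R\<close> is a fixed entry of
      \<open>U\<close>, so its column lies in \<open>?J\<close>, where the combination of the rows
      of T vanishes.\<close>
    moreover have "(\<Sum>k<L. y k * net_Twr (M \<theta>0) $$ (k, j)) = 0" if a: "a = i"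
    proof -
      have entry: "netR (M \<theta>') $$ (i, j) = netR (M \<theta>'') $$ (i, j)" if "\<theta>' \<in> \<Theta>" "\<theta>'' \<in> \<Theta>" for \<theta>' \<theta>''
        using param_cols_fixed[OF that, of j "\<lambda>\<theta>. netR (M \<theta>)" i] t(4) a aj models[OF that(1)]
        by (auto simp: network_model_def)
      have "netU (M \<theta>') $$ (i, j) = netU (M \<theta>'') $$ (i, j)" if "\<theta>' \<in> \<Theta>" "\<theta>'' \<in> \<Theta>" for \<theta>' \<theta>''
        using entry[OF that] U[OF that(1) i, of j] U[OF that(2) i, of j] aj by simp
      then have "j \<notin> param_cols \<Theta> (\<lambda>\<theta>. netU (M \<theta>)) i" unfolding param_cols_def by blast
      then have "j \<in> ?J" using aj by simp
      from yT[OF this] show ?thesis using T aj by simp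
    qed
    ultimately have "netR m1 $$ (a, j) = R $$ (a, j)" using eR by blast
    also have "\<dots> = netR (M \<theta>) $$ (a, j)"
      using param_cols_fixed[OF t(1) \<theta>, of j "\<lambda>\<theta>. netR (M \<theta>)" a] t(3,4) by simp
    finally show "netR m1 $$ (a, j) = netR (M \<theta>) $$ (a, j)" .
  qed
  have sH: "same_fixed_entries \<Theta> (\<lambda>\<theta>. netH (M \<theta>)) (netH m1)"
    unfolding same_fixed_entries_def
  proof (intro ballI allI impI)
    fix \<theta> a j assume t: "\<theta> \<in> \<Theta>" "a < dim_row (netH (M \<theta>))" "j < dim_col (netH (M \<theta>))"
      "j \<notin> param_cols \<Theta> (\<lambda>\<theta>. netH (M \<theta>)) a"
    then have aj: "a < L" "j < p" using models[OF t(1)] by (auto simp: network_model_def)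
    \<comment> \<open>As for \<open>R\<close>, with the columns of \<open>H\<close> shifted by
      \<open>K\<close> inside \<open>U\<close>.\<close>
    moreover have "(\<Sum>k<L. y k * net_Twe (M \<theta>0) $$ (k, j)) = 0" if a: "a = i"
    proof -
      have entry: "netH (M \<theta>') $$ (i, j) = netH (M \<theta>'') $$ (i, j)" if "\<theta>' \<in> \<Theta>" "\<theta>'' \<in> \<Theta>" for \<theta>' \<theta>''
        using param_cols_fixed[OF that, of j "\<lambda>\<theta>. netH (M \<theta>)" i] t(4) a aj models[OF that(1)]
        by (auto simp: network_model_def)
      have "netU (M \<theta>') $$ (i, K + j) = netU (M \<theta>'') $$ (i, K + j)" if "\<theta>' \<in> \<Theta>" "\<theta>'' \<in> \<Theta>" for \<theta>' \<theta>''
        using entry[OF that] U[OF that(1) i, of "K + j"] U[OF that(2) i, of "K + j"] aj by simp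
      then have "K + j \<notin> param_cols \<Theta> (\<lambda>\<theta>. netU (M \<theta>)) i" unfolding param_cols_def by blast
      then have "K + j \<in> ?J" using aj by simp
      from yT[OF this] show ?thesis using T aj by simp
    qed
    ultimately have "netH m1 $$ (a, j) = H $$ (a, j)" using eH by blast
    also have "\<dots> = netH (M \<theta>) $$ (a, j)"
      using param_cols_fixed[OF t(1) \<theta>, of j "\<lambda>\<theta>. netH (M \<theta>)" a] t(3,4) by simp
    finally show "netH m1 $$ (a, j) = netH (M \<theta>) $$ (a, j)" .
  qed
  have "req m1"
    using req m1 models[OF \<theta>] unfolding requirement_depends_on_response_def by blast
  then have "m1 \<in> M ` \<Theta>"
    using free \<theta> m1(1,2) sG sR sH unfolding freely_parametrized_def by blast
  then obtain \<theta>1 where t1: "\<theta>1 \<in> \<Theta>" "m1 = M \<theta>1" by blast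
  have "net_Phi m1 = net_Phi (M \<theta>0)" using m1(2,4) by (simp add: net_Phi_def fun_eq_iff)
  then have "m1 = M \<theta>0"
    using id t1 m1(3) unfolding globally_identifiable_at_def by blast
  then show False using m1(8) by simp
qed

theorem theorem2:
  fixes L K p :: nat
    and \<Theta> :: "'a set"
    and M :: "'a \<Rightarrow> net_model"
  assumes model_set: "network_model_set L K p \<Theta> M"
    and cond:
      "(cond_C1 L \<Theta> M \<and> freely_parametrized L K p \<Theta> M (req_C1 L)) \<or>
       (\<exists>P. cond_C2 L \<Theta> M P \<and> freely_parametrized L K p \<Theta> M (req_C2 P)) \<or>
       (cond_C3 L K \<Theta> M \<and> freely_parametrized L K p \<Theta> M (req_C3 L K \<Theta> M))"
  shows
    "(\<forall>\<theta>0 \<in> \<Theta>. globally_identifiable_at \<Theta> M \<theta>0 \<longleftrightarrow>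
        (\<forall>i < L. card (param_cols \<Theta> (\<lambda>\<theta>. netGU (M \<theta>)) i) \<le> K + p) \<and>
        (\<forall>i < L. full_row_rank (T_check K p \<Theta> M \<theta>0 i))) \<and>
     (globally_identifiable \<Theta> M \<longleftrightarrow>
        (\<forall>i < L. card (param_cols \<Theta> (\<lambda>\<theta>. netGU (M \<theta>)) i) \<le> K + p) \<and>
        (\<forall>i < L. \<forall>\<theta> \<in> \<Theta>. full_row_rank (T_check K p \<Theta> M \<theta> i)))"
proof -
  have weak: "cond_C1 L \<Theta> M \<or> (\<exists>P. cond_C2 L \<Theta> M P) \<or> cond_C3 L K \<Theta> M" using cond by blast
  have at: "globally_identifiable_at \<Theta> M \<theta>0 \<longleftrightarrow>
        (\<forall>i < L. card (param_cols \<Theta> (\<lambda>\<theta>. netGU (M \<theta>)) i) \<le> K + p) \<and>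
        (\<forall>i < L. full_row_rank (T_check K p \<Theta> M \<theta>0 i))" if \<theta>: "\<theta>0 \<in> \<Theta>" for \<theta>0
  proof
    assume id: "globally_identifiable_at \<Theta> M \<theta>0"
    obtain req where "freely_parametrized L K p \<Theta> M req" "requirement_depends_on_response L K p req"
      "req (M \<theta>0)"
      using cond
    proof (elim disjE exE conjE)
      assume "cond_C1 L \<Theta> M" "freely_parametrized L K p \<Theta> M (req_C1 L)"
      then show thesis
        using that[of "req_C1 L"] requirements_depend_on_response(1) \<theta> by (simp add: cond_C1_def)
    next
      fix P assume "cond_C2 L \<Theta> M P" "freely_parametrized L K p \<Theta> M (req_C2 P)"
      then show thesis
        using that[of "req_C2 P"] requirements_depend_on_response(2) \<theta> by (simp add: cond_C2_def)
    next
      assume C3: "cond_C3 L K \<Theta> M" and free: "freely_parametrized L K p \<Theta> M (req_C3 L K \<Theta> M)"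
      \<comment> \<open>A member of the set shares its fixed entries by definition;
        \<open>req_C3\<close> states this because it also judges candidates not yet known to be
        members.\<close>
      have "same_fixed_entries \<Theta> (G_inf M) (mat_inf (netG (M \<theta>0)))"
        unfolding same_fixed_entries_def G_inf_def[of M \<theta>0, symmetric]
        using param_cols_fixed[OF _ \<theta>, of _ _ "G_inf M"] by metis
      moreover have "same_fixed_entries \<Theta> (R_inf M) (mat_inf (netR (M \<theta>0)))"
        unfolding same_fixed_entries_def R_inf_def[of M \<theta>0, symmetric]
        using param_cols_fixed[OF _ \<theta>, of _ _ "R_inf M"] by metis
      ultimately have "req_C3 L K \<Theta> M (M \<theta>0)"
        using C3 \<theta> by (simp add: req_C3_def cond_C3_def)
      then show thesis using that[OF free requirements_depend_on_response(3)] by blast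
    qed
    then have "full_row_rank (T_check K p \<Theta> M \<theta>0 i)" if "i < L" for i
      using full_row_rank_of_identifiable[OF model_set \<theta> that] id by blast
    then show "(\<forall>i < L. card (param_cols \<Theta> (\<lambda>\<theta>. netGU (M \<theta>)) i) \<le> K + p) \<and>
        (\<forall>i < L. full_row_rank (T_check K p \<Theta> M \<theta>0 i))"
      using card_param_cols_le[OF model_set \<theta>] by blast
  next
    assume "(\<forall>i < L. card (param_cols \<Theta> (\<lambda>\<theta>. netGU (M \<theta>)) i) \<le> K + p) \<and>
        (\<forall>i < L. full_row_rank (T_check K p \<Theta> M \<theta>0 i))"
    then show "globally_identifiable_at \<Theta> M \<theta>0"
      unfolding globally_identifiable_at_def
      using response_determines_model[OF model_set \<theta>]
        response_determines_noise_model[OF model_set weak \<theta>] by blast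
  qed
  \<comment> \<open>With an empty parameter set the pointwise equivalence says nothing, but then no
    entry is parametrized and both sides of the second claim hold.\<close>
  have "card (param_cols \<Theta> (\<lambda>\<theta>. netGU (M \<theta>)) i) \<le> K + p" if "\<Theta> = {}" for i
    using that by (simp add: param_cols_def)
  then show ?thesis using at unfolding globally_identifiable_def by blast
qed

end
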